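(* Let $B$ be a von Neumann algebra and let $(A,E)$ be a $B$-valued W$^*$-noncommutative probability space. Suppose $a\in A$ is $B$-valued R-diagonal and $a=v|a|$ is its polar decomposition. Then the partial isometry $v$ is $B$-valued R-diagonal.
   Context: A $B$-valued W$^*$-noncommutative probability space is a pair $(A,E)$ where $A$ is a von Neumann algebra containing a unitally embedded copy of the von Neumann algebra $B$ and $E:A\to B$ is a normal conditional expectation (positive, $*$-preserving, linear, $E|_B=\mathrm{id}$, $E(b_1ab_2)=b_1E(a)b_2$). Given $n\ge1$ and $\varepsilon\in\{1,*\}^n$, the maximal alternating interval partition $\sigma(\varepsilon)$ is the interval partition of $\{1,\ldots,n\}$ whose blocks $V$ are the maximal interval subsets such that if $j\in V$ and $j+1\in V$ then $\varepsilon(j)\ne\varepsilon(j+1)$. An element $a\in A$ is $B$-valued R-diagonal if for every $k\ge0$ and $b_1,\ldots,b_{2k}\in B$ $$E(ab_1a^*b_2ab_3a^*\cdots b_{2k-2}ab_{2k-1}a^*b_{2k}a)=0,$$ and for every $n\ge1$, $\varepsilon\in\{1,*\}^n$ and $b_1,\ldots,b_n\in B$ $$E\Bigl(\prod_{V\in\sigma(\varepsilon)}\Bigl(\Bigl(\prod_{j\in V}a^{\varepsilon(j)}b_j\Bigr)-E\Bigl(\prod_{j\in V}a^{\varepsilon(j)}b_j\Bigr)\Bigr)\Bigr)=0,$$ where all products are taken in order of increasing indices. In the polar decomposition, $|a|=(a^*a)^{1/2}$ and $v$ is the partial isometry with $v^*v$ equal to the support projection $1_{(0,\infty)}(a^*a)$.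 *)

theory Defs
  imports "HOL-Analysis.Analysis"
begin

section \<open>Bounded operators on a complex Hilbert space\<close>

class scaleC =
  fixes scaleC :: "complex \<Rightarrow> 'a \<Rightarrow> 'a"  (infixr "*\<^sub>C" 75)

text \<open>The inner product is linear in the second argument. Positivity and definiteness follow
  from the last axiom; completeness comes from \<^class>\<open>banach\<close>.\<close>

class complex_hilbert_space = banach + scaleC +
  fixes cinner :: "'a \<Rightarrow> 'a \<Rightarrow> complex"
  assumes scaleC_add_right: "c *\<^sub>C (x + y) = c *\<^sub>C x + c *\<^sub>C y"
    and scaleC_add_left: "(c + d) *\<^sub>C x = c *\<^sub>C x + d *\<^sub>C x"
    and scaleC_scaleC: "c *\<^sub>C (d *\<^sub>C x) = (c * d) *\<^sub>C x"
    and scaleR_scaleC: "r *\<^sub>R x = complex_of_real r *\<^sub>C x"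
    and cinner_commute: "cinner x y = cnj (cinner y x)"
    and cinner_add_right: "cinner x (y + z) = cinner x y + cinner x z"
    and cinner_scaleC_right: "cinner x (c *\<^sub>C y) = c * cinner x y"
    and cinner_self: "cinner x x = complex_of_real ((norm x)\<^sup>2)"

typedef (overloaded) 'h bop =
  "{f :: 'h::complex_hilbert_space \<Rightarrow> 'h. bounded_linear f \<and> (\<forall>c x. f (c *\<^sub>C x) = c *\<^sub>C f x)}"
  morphisms app Bop
proof
  show "(\<lambda>x. x) \<in> {f :: 'h \<Rightarrow> 'h. bounded_linear f \<and> (\<forall>c x. f (c *\<^sub>C x) = c *\<^sub>C f x)}"
    by (simp add: bounded_linear_ident)
qed

setup_lifting type_definition_bop

lemma scaleC_zero_right: "c *\<^sub>C (0 :: 'h::complex_hilbert_space) = 0"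
  using scaleC_add_right[of c 0 "0::'h"] by simp

lemma scaleC_minus_right: "c *\<^sub>C (- x) = - (c *\<^sub>C (x :: 'h::complex_hilbert_space))"
  using scaleC_add_right[of c x "- x"] by (simp add: scaleC_zero_right eq_neg_iff_add_eq_0 add.commute)

lemma norm_scaleC: "norm (c *\<^sub>C (x :: 'h::complex_hilbert_space)) = cmod c * norm x"
proof -
  have "cinner (c *\<^sub>C x) (c *\<^sub>C x) = c * cnj c * cinner x x"
    by (metis cinner_scaleC_right cinner_commute complex_cnj_mult mult.assoc complex_cnj_cnj)
  then have "complex_of_real ((norm (c *\<^sub>C x))\<^sup>2) = complex_of_real ((cmod c * norm x)\<^sup>2)"
    by (simp only: cinner_self complex_norm_square[symmetric] power_mult_distrib of_real_mult)
  then have "(norm (c *\<^sub>C x))\<^sup>2 = (cmod c * norm x)\<^sup>2"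
    by (simp only: of_real_eq_iff)
  then show ?thesis by simp
qed

lemma bounded_linear_scaleC: "bounded_linear (\<lambda>x :: 'h::complex_hilbert_space. c *\<^sub>C x)"
proof
  show "c *\<^sub>C (r *\<^sub>R x) = r *\<^sub>R (c *\<^sub>C x)" for r and x :: 'h
    by (simp add: scaleR_scaleC scaleC_scaleC mult.commute)
  show "\<exists>K. \<forall>x :: 'h. norm (c *\<^sub>C x) \<le> norm x * K"
    by (metis norm_scaleC mult.commute order_refl)
qed (simp add: scaleC_add_right)

text \<open>Multiplication of operators is composition. The class \<open>ring_1\<close> is not available, since
  it excludes the zero Hilbert space.\<close>

instantiation bop :: (complex_hilbert_space) "{ring, monoid_mult, scaleC}"
begin

lift_definition zero_bop :: "'a bop" is "\<lambda>_. 0"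
  by (simp add: scaleC_zero_right)

lift_definition one_bop :: "'a bop" is "\<lambda>x. x"
  by (simp add: bounded_linear_ident)

lift_definition plus_bop :: "'a bop \<Rightarrow> 'a bop \<Rightarrow> 'a bop" is "\<lambda>f g x. f x + g x"
  by (simp add: bounded_linear_add scaleC_add_right)

lift_definition uminus_bop :: "'a bop \<Rightarrow> 'a bop" is "\<lambda>f x. - f x"
  by (simp add: bounded_linear_minus scaleC_minus_right)

lift_definition minus_bop :: "'a bop \<Rightarrow> 'a bop \<Rightarrow> 'a bop" is "\<lambda>f g x. f x - g x"
  by (simp only: diff_conv_add_uminus)
     (simp add: bounded_linear_add bounded_linear_minus scaleC_add_right scaleC_minus_right
       del: add_uminus_conv_diff)

lift_definition times_bop :: "'a bop \<Rightarrow> 'a bop \<Rightarrow> 'a bop" is "\<lambda>f g x. f (g x)"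
  by (simp add: bounded_linear_compose)

lift_definition scaleC_bop :: "complex \<Rightarrow> 'a bop \<Rightarrow> 'a bop" is "\<lambda>c f x. c *\<^sub>C f x"
  by (simp add: bounded_linear_compose[OF bounded_linear_scaleC] scaleC_scaleC mult.commute)

instance
proof
  fix a b c :: "'a bop"
  show "a * b * c = a * (b * c)" "1 * a = a" "a * 1 = a" "a + b + c = a + (b + c)"
    "a + b = b + a" "0 + a = a" "- a + a = 0" "a - b = a + - b" "(a + b) * c = a * c + b * c"
    by (transfer; simp add: algebra_simps)+
  show "a * (b + c) = a * b + a * c"
    by transfer (simp add: linear_simps)
qed

end

definition adj :: "'h::complex_hilbert_space bop \<Rightarrow> 'h bop" where
  "adj T = (THE S. \<forall>x y. cinner (app S x) y = cinner x (app T y))"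

definition positive :: "'h::complex_hilbert_space bop \<Rightarrow> bool" where
  "positive T \<longleftrightarrow> (\<forall>x. cinner x (app T x) \<in> \<real>\<^sub>\<ge>\<^sub>0)"

definition projection :: "'h::complex_hilbert_space bop \<Rightarrow> bool" where
  "projection p \<longleftrightarrow> adj p = p \<and> p * p = p"

definition partial_isometry :: "'h::complex_hilbert_space bop \<Rightarrow> bool" where
  "partial_isometry v \<longleftrightarrow> projection (adj v * v)"

text \<open>\<open>p\<close> is the smallest projection with \<open>x * p = x\<close>. For positive \<open>x\<close> this is the spectral
  projection of \<open>x\<close> for the interval from \<open>0\<close> (excluded) to infinity.\<close>

definition is_support_projection ::
    "'h::complex_hilbert_space bop \<Rightarrow> 'h bop \<Rightarrow> bool" where
  "is_support_projection x p \<longleftrightarrow>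
     projection p \<and> x * p = x \<and> (\<forall>q. projection q \<and> x * q = x \<longrightarrow> positive (q - p))"

text \<open>\<open>a = v * h\<close> is the polar decomposition of \<open>a\<close>. The first two conjuncts determine \<open>h\<close> as
  the positive square root of \<open>adj a * a\<close>, the absolute value of \<open>a\<close>.\<close>

definition polar_decomposition ::
    "'h::complex_hilbert_space bop \<Rightarrow> 'h bop \<Rightarrow> 'h bop \<Rightarrow> bool" where
  "polar_decomposition a v h \<longleftrightarrow>
     positive h \<and> h * h = adj a * a \<and> a = v * h \<and>
     partial_isometry v \<and> is_support_projection (adj a * a) (adj v * v)"

section \<open>Operator-valued W*-noncommutative probability spaces\<close>

definition commutant :: "'h::complex_hilbert_space bop set \<Rightarrow> 'h bop set" where
  "commutant M = {T. \<forall>S\<in>M. T * S = S * T}"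

definition von_neumann_algebra :: "'h::complex_hilbert_space bop set \<Rightarrow> bool" where
  "von_neumann_algebra M \<longleftrightarrow> (\<forall>T\<in>M. adj T \<in> M) \<and> commutant (commutant M) = M"

definition square_summable :: "(nat \<Rightarrow> 'h::complex_hilbert_space) \<Rightarrow> bool" where
  "square_summable \<xi> \<longleftrightarrow> summable (\<lambda>n. (norm (\<xi> n))\<^sup>2)"

definition ultraweak_topology :: "'h::complex_hilbert_space bop topology" where
  "ultraweak_topology = topology_generated_by
     {{T. (\<Sum>n. cinner (\<xi> n) (app T (\<eta> n))) \<in> U} | \<xi> \<eta> U.
        square_summable \<xi> \<and> square_summable \<eta> \<and> open U}"

definition normal_map ::
    "'h::complex_hilbert_space bop set \<Rightarrow> 'h bop set \<Rightarrow> ('h bop \<Rightarrow> 'h bop) \<Rightarrow> bool" where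
  "normal_map A B E \<longleftrightarrow>
     continuous_map (subtopology ultraweak_topology A) (subtopology ultraweak_topology B) E"

definition conditional_expectation ::
    "'h::complex_hilbert_space bop set \<Rightarrow> 'h bop set \<Rightarrow> ('h bop \<Rightarrow> 'h bop) \<Rightarrow> bool" where
  "conditional_expectation A B E \<longleftrightarrow>
     (\<forall>x\<in>A. E x \<in> B) \<and>
     (\<forall>x\<in>A. positive x \<longrightarrow> positive (E x)) \<and>
     (\<forall>x\<in>A. E (adj x) = adj (E x)) \<and>
     (\<forall>x\<in>A. \<forall>y\<in>A. E (x + y) = E x + E y) \<and>
     (\<forall>c. \<forall>x\<in>A. E (c *\<^sub>C x) = c *\<^sub>C E x) \<and>
     (\<forall>b\<in>B. E b = b) \<and>
     (\<forall>b\<^sub>1\<in>B. \<forall>b\<^sub>2\<in>B. \<forall>x\<in>A. E (b\<^sub>1 * x * b\<^sub>2) = b\<^sub>1 * E x * b\<^sub>2)"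

text \<open>The copy of \<open>B\<close> inside \<open>A\<close> is identified with \<open>B\<close>. The embedding is unital because a von
  Neumann algebra in the above sense contains the identity operator \<open>1\<close>.\<close>

definition W_noncommutative_probability_space ::
    "'h::complex_hilbert_space bop set \<Rightarrow> 'h bop set \<Rightarrow> ('h bop \<Rightarrow> 'h bop) \<Rightarrow> bool" where
  "W_noncommutative_probability_space B A E \<longleftrightarrow>
     von_neumann_algebra B \<and> von_neumann_algebra A \<and> B \<subseteq> A \<and>
     conditional_expectation A B E \<and> normal_map A B E"

section \<open>R-diagonal elements\<close>

datatype exponent = One | Star

fun starpow :: "'h::complex_hilbert_space bop \<Rightarrow> exponent \<Rightarrow> 'h bop" where
  "starpow a One = a"
| "starpow a Star = adj a"

definition alternating_interval :: "nat \<Rightarrow> (nat \<Rightarrow> exponent) \<Rightarrow> nat set \<Rightarrow> bool" where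
  "alternating_interval n \<epsilon> V \<longleftrightarrow>
     (\<exists>l u. 1 \<le> l \<and> l \<le> u \<and> u \<le> n \<and> V = {l..u}) \<and>
     (\<forall>j. j \<in> V \<and> j + 1 \<in> V \<longrightarrow> \<epsilon> j \<noteq> \<epsilon> (j + 1))"

definition max_alternating_partition :: "nat \<Rightarrow> (nat \<Rightarrow> exponent) \<Rightarrow> nat set set" where
  "max_alternating_partition n \<epsilon> =
     {V. alternating_interval n \<epsilon> V \<and>
         (\<forall>W. alternating_interval n \<epsilon> W \<and> V \<subseteq> W \<longrightarrow> W = V)}"

definition block_product ::
    "'h::complex_hilbert_space bop \<Rightarrow> (nat \<Rightarrow> exponent) \<Rightarrow> (nat \<Rightarrow> 'h bop) \<Rightarrow> nat set \<Rightarrow> 'h bop" where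
  "block_product a \<epsilon> b V = prod_list (map (\<lambda>j. starpow a (\<epsilon> j) * b j) (sorted_list_of_set V))"

text \<open>In the first family of moments the factor for \<open>i\<close> is
  \<open>b\<^sub>2\<^sub>i\<^sub>+\<^sub>1 a\<^sup>* b\<^sub>2\<^sub>i\<^sub>+\<^sub>2 a\<close>, so that the word is \<open>a b\<^sub>1 a\<^sup>* b\<^sub>2 a \<dots> b\<^sub>2\<^sub>k\<^sub>-\<^sub>1 a\<^sup>* b\<^sub>2\<^sub>k a\<close>.
  In the second one the blocks are listed in increasing order of their minima.\<close>

definition R_diagonal ::
    "'h::complex_hilbert_space bop set \<Rightarrow> 'h bop set \<Rightarrow> ('h bop \<Rightarrow> 'h bop) \<Rightarrow> 'h bop \<Rightarrow> bool" where
  "R_diagonal B A E a \<longleftrightarrow>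
     a \<in> A \<and>
     (\<forall>k b. (\<forall>i\<in>{1..2 * k}. b i \<in> B) \<longrightarrow>
        E (a * prod_list (map (\<lambda>i. b (2 * i + 1) * adj a * b (2 * i + 2) * a) [0..<k])) = 0) \<and>
     (\<forall>n\<ge>1. \<forall>\<epsilon> b. (\<forall>j\<in>{1..n}. b j \<in> B) \<longrightarrow>
        E (prod_list
             (map (\<lambda>V. block_product a \<epsilon> b V - E (block_product a \<epsilon> b V))
                (sorted_key_list_of_set Min (max_alternating_partition n \<epsilon>)))) = 0)"

end

theory Submission imports Defs begin

text \<open>The polar part \<open>v\<close> is a bounded strong-* limit of odd polynomials in \<open>a\<close>: after scaling \<open>a\<close> to a
  contraction, the Newton--Schulz iteration \<open>w \<mapsto> (3 w - w w\<^sup>* w) / 2\<close> acts on the absolute value as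
  \<open>y \<mapsto> (3 y - y\<^sup>3) / 2\<close>, which increases to the support projection. R-diagonality passes from \<open>w\<close> to
  \<open>\<alpha> w + \<beta> w w\<^sup>* w\<close>, because expanding a word in the latter gives words in \<open>w\<close> with the same
  maximal alternating blocks and the same end exponents. It also passes to bounded strong-* limits,
  because a normal conditional expectation is strongly continuous on bounded sequences.\<close>

section \<open>Adjoints of bounded operators\<close>

text \<open>In general \<open>v\<close> is not even a norm limit of polynomials in \<open>a\<close>,
  so the transfer has to survive a strong limit. This is the delicate point: in a centered word
  \<open>E\<close> stands inside a product, products are not weakly continuous, and normality of
  \<open>E\<close> by itself yields only ultraweak limits. Hence strong limits with uniform bounds
  are used throughout. Since the adjoint is not strongly continuous, the convergence of
  \<open>adj (w n)\<close> to \<open>adj v\<close> is carried separately. Each iteration step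
  involves only the two words \<open>w\<close> and \<open>w * adj w * w\<close>, with real
  coefficients, so a single substitution result serves all iterates. For the convergence, positivity
  of polynomials in one positive contraction \<open>h\<close> replaces the spectral theorem. The
  error of the \<open>n\<close>-th iterate is dominated by the \<open>n\<close>-th power of
  \<open>1 - h/2\<close>. These powers decrease to the projection onto the kernel of
  \<open>h\<close>, and minimality of the support projection makes that projection orthogonal to
  \<open>adj v * v\<close>.\<close>

lemma cinner_add_left: "cinner (x + y) z = cinner x z + cinner y (z :: 'h::complex_hilbert_space)"
  by (metis cinner_add_right cinner_commute complex_cnj_add)

lemma cinner_scaleC_left: "cinner (c *\<^sub>C x) y = cnj c * cinner x (y :: 'h::complex_hilbert_space)"
  by (metis cinner_scaleC_right cinner_commute complex_cnj_mult)

lemma cinner_scaleR_right: "cinner x (r *\<^sub>R y) = r *\<^sub>R cinner x (y :: 'h::complex_hilbert_space)"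
  by (simp add: scaleR_scaleC cinner_scaleC_right scaleR_conv_of_real)

lemma cinner_scaleR_left: "cinner (r *\<^sub>R x) y = r *\<^sub>R cinner x (y :: 'h::complex_hilbert_space)"
  by (simp add: scaleR_scaleC cinner_scaleC_left scaleR_conv_of_real)

lemma cinner_diff_left: "cinner (x - y) z = cinner x z - cinner y (z :: 'h::complex_hilbert_space)"
  using cinner_add_left[of "x - y" y z] by simp

lemma cinner_diff_right: "cinner z (x - y) = cinner z x - cinner z (y :: 'h::complex_hilbert_space)"
  using cinner_add_right[of z "x - y" y] by simp

lemma Re_cinner_self: "Re (cinner x x) = (norm (x :: 'h::complex_hilbert_space))\<^sup>2"
  by (simp add: cinner_self)

lemma Re_cinner_commute: "Re (cinner x y) = Re (cinner y (x :: 'h::complex_hilbert_space))"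
  by (subst cinner_commute) simp

lemma norm_add_sq:
  "(norm (x + y :: 'h::complex_hilbert_space))\<^sup>2 = (norm x)\<^sup>2 + 2 * Re (cinner x y) + (norm y)\<^sup>2"
  using Re_cinner_commute[of y x]
  by (simp add: cinner_add_left cinner_add_right flip: Re_cinner_self)

lemma norm_diff_sq:
  "(norm (x - y :: 'h::complex_hilbert_space))\<^sup>2 = (norm x)\<^sup>2 - 2 * Re (cinner x y) + (norm y)\<^sup>2"
  using Re_cinner_commute[of y x]
  by (simp add: cinner_diff_left cinner_diff_right flip: Re_cinner_self)

text \<open>Expand the squared norm of \<open>r *\<^sub>R y - c *\<^sub>C x\<close>, with
  \<open>r\<close> the squared norm of \<open>x\<close> and \<open>c = cinner x y\<close>, and
  cancel the positive factor \<open>r\<close>.\<close>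

lemma Cauchy_Schwarz: "cmod (cinner x y) \<le> norm x * norm (y :: 'h::complex_hilbert_space)"
proof (cases "x = 0")
  case True
  have "cinner 0 y = 0"
    using cinner_add_left[of 0 0 y] by simp
  with True show ?thesis by simp
next
  case False
  define c where "c = cinner x y"
  define r where "r = (norm x)\<^sup>2"
  have "r > 0"
    using False by (simp add: r_def)
  have "cinner (r *\<^sub>R y) (c *\<^sub>C x) = complex_of_real (r * (cmod c)\<^sup>2)"
    using cinner_commute[of y x] complex_norm_square[of c]
    by (simp add: cinner_scaleR_left cinner_scaleC_right scaleR_conv_of_real c_def)
  then have "(norm (r *\<^sub>R y - c *\<^sub>C x))\<^sup>2 = r\<^sup>2 * (norm y)\<^sup>2 - 2 * (r * (cmod c)\<^sup>2) + (cmod c)\<^sup>2 * r"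
    by (simp add: norm_diff_sq norm_scaleC power_mult_distrib r_def)
  also have "\<dots> = r * (r * (norm y)\<^sup>2 - (cmod c)\<^sup>2)"
    by (simp add: algebra_simps power2_eq_square)
  finally have "0 \<le> r * (r * (norm y)\<^sup>2 - (cmod c)\<^sup>2)"
    by (metis zero_le_power2)
  with \<open>r > 0\<close> have "(cmod c)\<^sup>2 \<le> (norm x * norm y)\<^sup>2"
    by (simp add: zero_le_mult_iff r_def power_mult_distrib)
  then show ?thesis
    by (simp add: c_def power2_le_iff_abs_le)
qed

interpretation cinner: bounded_bilinear "cinner :: 'h::complex_hilbert_space \<Rightarrow> 'h \<Rightarrow> complex"
  by standard
    (auto simp: cinner_add_left cinner_add_right cinner_scaleR_left cinner_scaleR_right
      intro!: exI[of _ 1] Cauchy_Schwarz)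

lemma cinner_eqI: "(\<And>y. cinner x y = cinner x' (y :: 'h::complex_hilbert_space)) \<Longrightarrow> x = x'"
  using cinner_self[of "x - x'"] by (simp add: cinner.diff_left)

text \<open>The representing vector minimizes \<open>\<parallel>y\<parallel>\<^sup>2 / 2 - Re (\<phi> y)\<close>.\<close>

lemma riesz_representation:
  fixes \<phi> :: "'h::complex_hilbert_space \<Rightarrow> complex"
  assumes bl: "bounded_linear \<phi>" and sc: "\<And>c x. \<phi> (c *\<^sub>C x) = c * \<phi> x"
  shows "\<exists>u. \<forall>y. cinner u y = \<phi> y"
proof -
  interpret \<phi>: bounded_linear \<phi> by fact
  define J where "J y = (norm y)\<^sup>2 / 2 - Re (\<phi> y)" for y
  obtain K where K: "\<And>y. cmod (\<phi> y) \<le> norm y * K"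
    using \<phi>.bounded by blast
  have "- (K\<^sup>2 / 2) \<le> J y" for y
  proof -
    have "Re (\<phi> y) \<le> norm y * K"
      using K[of y] complex_Re_le_cmod[of "\<phi> y"] by linarith
    moreover have "0 \<le> (norm y - K)\<^sup>2" by simp
    ultimately show ?thesis
      unfolding J_def by (simp add: power2_diff)
  qed
  then have bdd: "bdd_below (range J)"
    by (auto simp: bdd_below_def)
  define m where "m = Inf (range J)"
  have m_le: "m \<le> J y" for y
    unfolding m_def using bdd by (simp add: cInf_lower)
  have "\<exists>y. J y < m + inverse (real (Suc n))" for n
  proof -
    have "Inf (range J) < m + inverse (real (Suc n))"
      unfolding m_def by (simp add: add_pos_nonneg)
    then show ?thesis
      using cInf_less_iff[of "range J"] bdd by blast
  qed
  then obtain Y where Y: "\<And>n. J (Y n) < m + inverse (real (Suc n))"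
    by metis
  \<comment> \<open>The linear parts of \<open>J\<close> cancel against the midpoint, and the
    parallelogram law leaves \<open>J y + J z - 2 * J ((y + z) / 2) = (norm (y - z))^2 / 4\<close>.
    Minimizing sequences are therefore Cauchy.\<close>
  have par: "(norm (y - z))\<^sup>2 \<le> 4 * (J y + J z - 2 * m)" for y z
  proof -
    have "J ((1/2) *\<^sub>R (y + z)) = (norm (y + z))\<^sup>2 / 8 - (Re (\<phi> y) + Re (\<phi> z)) / 2"
      unfolding J_def by (simp add: \<phi>.scaleR \<phi>.add power_divide)
    moreover have "m \<le> J ((1/2) *\<^sub>R (y + z))"
      by (rule m_le)
    ultimately show ?thesis
      unfolding J_def by (simp add: norm_add_sq norm_diff_sq field_simps)
  qed
  have "Cauchy Y"
  proof (rule metric_CauchyI)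
    fix e :: real assume "e > 0"
    then obtain N where N: "inverse (real (Suc N)) < e\<^sup>2 / 8"
      using reals_Archimedean[of "e\<^sup>2 / 8"] by auto
    have "dist (Y i) (Y j) < e" if "N \<le> i" "N \<le> j" for i j
    proof -
      have "inverse (real (Suc i)) \<le> inverse (real (Suc N))"
        "inverse (real (Suc j)) \<le> inverse (real (Suc N))"
        using that by (auto intro!: le_imp_inverse_le)
      with Y[of i] Y[of j] N have "J (Y i) < m + e\<^sup>2 / 8" "J (Y j) < m + e\<^sup>2 / 8"
        by (metis add_left_mono order.strict_trans order.strict_trans1 add_strict_left_mono)+
      then have "(norm (Y i - Y j))\<^sup>2 < e\<^sup>2"
        using par[of "Y i" "Y j"] by (simp add: field_simps)
      then show ?thesis
        using \<open>e > 0\<close> by (simp add: dist_norm power2_less_imp_less)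
    qed
    then show "\<exists>M. \<forall>i\<ge>M. \<forall>j\<ge>M. dist (Y i) (Y j) < e" by blast
  qed
  then obtain u where u: "Y \<longlonglongrightarrow> u"
    using Cauchy_convergent convergent_def by blast
  have "(\<lambda>n. J (Y n)) \<longlonglongrightarrow> J u"
    unfolding J_def by (intro tendsto_intros \<phi>.tendsto u) auto
  moreover have "(\<lambda>n. m + inverse (real (Suc n))) \<longlonglongrightarrow> m + 0"
    by (intro tendsto_intros LIMSEQ_inverse_real_of_nat)
  ultimately have "J u \<le> m + 0"
    by (rule LIMSEQ_le) (use Y less_imp_le in blast)
  then have min: "J u \<le> J y" for y
    using m_le[of y] by simp
  have Re_eq: "Re (cinner u z) = Re (\<phi> z)" for z
  proof -
    define d where "d = Re (cinner u z) - Re (\<phi> z)"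
    define q where "q = (norm z)\<^sup>2 / 2"
    \<comment> \<open>A move against the slope \<open>d\<close> of \<open>J\<close> in direction
      \<open>z\<close>. For this length \<open>t * d + t^2 * q\<close> equals \<open>- t^2\<close>,
      yet minimality makes it nonnegative. The \<open>+ 1\<close> covers
      \<open>q = 0\<close>.\<close>
    define t where "t = - d / (q + 1)"
    have "q \<ge> 0" by (simp add: q_def)
    have "J (u + t *\<^sub>R z) = J u + t * d + t\<^sup>2 * q"
      unfolding J_def d_def q_def
      by (simp add: norm_add_sq \<phi>.add \<phi>.scaleR cinner.scaleR_right power_mult_distrib algebra_simps
          add_divide_distrib)
    then have "0 \<le> t * d + t\<^sup>2 * q"
      using min[of "u + t *\<^sub>R z"] by simp
    moreover have d: "d = - t * (q + 1)"
      using \<open>q \<ge> 0\<close> by (simp add: t_def)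
    ultimately have "t = 0"
      by (simp add: algebra_simps power2_eq_square) (metis mult_eq_0_iff not_le not_square_less_zero order.antisym)
    with d have "d = 0" by simp
    then show ?thesis by (simp add: d_def)
  qed
  \<comment> \<open>The real part of a complex-linear functional determines it: the imaginary part
    is read off at \<open>\<i> *\<^sub>C y\<close>.\<close>
  have "cinner u y = \<phi> y" for y
    using Re_eq[of y] Re_eq[of "\<i> *\<^sub>C y"] by (simp add: complex_eq_iff sc cinner_scaleC_right)
  then show ?thesis by blast
qed

section \<open>Existence and algebra of adjoints\<close>

lemmas app_simps = zero_bop.rep_eq one_bop.rep_eq plus_bop.rep_eq uminus_bop.rep_eq
  minus_bop.rep_eq times_bop.rep_eq scaleC_bop.rep_eq

lemma bounded_linear_app: "bounded_linear (app T)"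
  using app[of T] by simp

lemmas linear_app = bounded_linear.linear[OF bounded_linear_app]

lemmas app_add = linear_add[OF linear_app]
  and app_diff = linear_diff[OF linear_app]

lemma app_scaleC: "app T (c *\<^sub>C x) = c *\<^sub>C app T x"
  using app[of T] by simp

lemma bop_eqI: "(\<And>x. app S x = app T x) \<Longrightarrow> S = T"
  by (simp add: app_inject[symmetric] fun_eq_iff)

lemma bop_cinner_eqI: "(\<And>x y. cinner (app S x) y = cinner (app T x) y) \<Longrightarrow> S = T"
  by (intro bop_eqI cinner_eqI)

lemma app_bound_ex: "\<exists>M>0. \<forall>x. norm (app T x) \<le> M * norm x"
  using bounded_linear.pos_bounded[OF bounded_linear_app, of T] by (metis mult.commute)

text \<open>\<open>adj\<close> is a definite description, so existence and uniqueness are due here.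
  Riesz supplies the values \<open>f x\<close>; the bound on \<open>f\<close> comes from
  \<open>(norm (f x))^2 = Re (cinner x (app T (f x)))\<close>.\<close>

lemma cinner_adj_left: "cinner (app (adj T) x) y = cinner x (app T y)"
proof -
  have "\<exists>u. \<forall>y. cinner u y = cinner x (app T y)" for x
    by (rule riesz_representation)
      (auto simp: app_scaleC cinner_scaleC_right
        intro: bounded_linear_compose[OF cinner.bounded_linear_right bounded_linear_app])
  then obtain f where f: "\<And>x y. cinner (f x) y = cinner x (app T y)"
    by metis
  have fadd: "f (x + y) = f x + f y" for x y
    by (rule cinner_eqI) (simp add: f cinner_add_left)
  have fsc: "f (c *\<^sub>C x) = c *\<^sub>C f x" for c x
    by (rule cinner_eqI) (simp add: f cinner_scaleC_left)
  obtain M where M: "M > 0" "\<And>x. norm (app T x) \<le> M * norm x"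
    using app_bound_ex by blast
  have fb: "norm (f x) \<le> norm x * M" for x
  proof -
    have "(norm (f x))\<^sup>2 = Re (cinner x (app T (f x)))"
      by (simp add: f flip: Re_cinner_self)
    also have "\<dots> \<le> norm x * norm (app T (f x))"
      using Cauchy_Schwarz complex_Re_le_cmod order_trans by blast
    also have "\<dots> \<le> norm x * (M * norm (f x))"
      by (intro mult_left_mono M) simp
    finally have "norm (f x) * norm (f x) \<le> (norm x * M) * norm (f x)"
      by (simp add: power2_eq_square mult.assoc)
    then show ?thesis
      using M(1) by (cases "f x = 0") auto
  qed
  have bl: "bounded_linear f"
    by (rule bounded_linear_intro[of _ M]) (auto simp: fadd scaleR_scaleC fsc fb)
  then have app_f: "app (Bop f) = f"
    by (simp add: Bop_inverse fsc)
  have "adj T = Bop f"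
    unfolding adj_def
    by (rule the_equality) (auto intro!: bop_cinner_eqI simp: app_f f)
  then show ?thesis by (simp add: app_f f)
qed

lemma cinner_adj_right: "cinner x (app (adj T) y) = cinner (app T x) y"
  by (metis cinner_adj_left cinner_commute)

lemma adj_eqI: "(\<And>x y. cinner (app S x) y = cinner x (app T y)) \<Longrightarrow> adj T = S"
  by (rule bop_cinner_eqI) (simp add: cinner_adj_left)

lemma adj_adj [simp]: "adj (adj T) = T"
  by (rule adj_eqI) (simp add: cinner_adj_right)

lemma adj_mult [simp]: "adj (S * T) = adj T * adj S"
  by (rule adj_eqI) (simp add: app_simps cinner_adj_left)

lemma adj_add [simp]: "adj (S + T) = adj S + adj T"
  by (rule adj_eqI) (simp add: app_simps cinner_adj_left cinner.add_left cinner.add_right)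

lemma adj_diff [simp]: "adj (S - T) = adj S - adj T"
  by (rule adj_eqI) (simp add: app_simps cinner_adj_left cinner.diff_left cinner.diff_right)

lemma adj_scaleC [simp]: "adj (c *\<^sub>C T) = cnj c *\<^sub>C adj T"
  by (rule adj_eqI) (simp add: app_simps cinner_adj_left cinner_scaleC_left cinner_scaleC_right)

lemma adj_one [simp]: "adj 1 = 1"
  by (rule adj_eqI) (simp add: app_simps)

lemma adj_zero [simp]: "adj 0 = 0"
  by (rule adj_eqI) (simp add: app_simps cinner.zero_left cinner.zero_right)

lemma bop_scaleC_simps:
  fixes S T :: "'h::complex_hilbert_space bop"
  shows "(c *\<^sub>C S) * T = c *\<^sub>C (S * T)" "S * (c *\<^sub>C T) = c *\<^sub>C (S * T)"
    "c *\<^sub>C (S + T) = c *\<^sub>C S + c *\<^sub>C T" "c *\<^sub>C (S - T) = c *\<^sub>C S - c *\<^sub>C T"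
    "c *\<^sub>C d *\<^sub>C T = (c * d) *\<^sub>C T" "1 *\<^sub>C T = T" "c *\<^sub>C (0 :: 'h bop) = 0" "0 *\<^sub>C T = 0"
    "(c + d) *\<^sub>C T = c *\<^sub>C T + d *\<^sub>C T"
proof -
  have one: "1 *\<^sub>C x = x" for x :: 'h
    using scaleR_scaleC[of 1 x] by simp
  have zero: "0 *\<^sub>C x = 0" for x :: 'h
    using scaleR_scaleC[of 0 x] by simp
  have diff: "c *\<^sub>C (x - y) = c *\<^sub>C x - c *\<^sub>C y" for x y :: 'h
    using scaleC_add_right[of c "x - y" y] by simp
  show "(c *\<^sub>C S) * T = c *\<^sub>C (S * T)" "S * (c *\<^sub>C T) = c *\<^sub>C (S * T)"
    "c *\<^sub>C (S + T) = c *\<^sub>C S + c *\<^sub>C T" "c *\<^sub>C (S - T) = c *\<^sub>C S - c *\<^sub>C T"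
    "c *\<^sub>C d *\<^sub>C T = (c * d) *\<^sub>C T" "1 *\<^sub>C T = T" "c *\<^sub>C (0 :: 'h bop) = 0" "0 *\<^sub>C T = 0"
    "(c + d) *\<^sub>C T = c *\<^sub>C T + d *\<^sub>C T"
    by (auto intro!: bop_eqI simp: app_simps app_scaleC scaleC_add_right scaleC_add_left
        scaleC_scaleC one zero diff scaleC_zero_right)
qed

lemma minus_bop_eq_scaleC: "- T = (-1) *\<^sub>C (T :: 'h::complex_hilbert_space bop)"
  using bop_scaleC_simps(9)[of 1 "-1" T]
  by (simp add: bop_scaleC_simps(6,8)) (metis add_eq_0_iff)

section \<open>Positive operators and bounded strong limits\<close>

text \<open>Polarization over the complex numbers: the sesquilinear defect \<open>D\<close> vanishes
  on the diagonal because the quadratic form is real, and testing at \<open>x + y\<close> and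
  \<open>x + \<i> *\<^sub>C y\<close> then makes it vanish everywhere.\<close>

lemma positive_iff_adj:
  "positive T \<longleftrightarrow> adj T = T \<and> (\<forall>x. 0 \<le> Re (cinner x (app T x)))"
proof
  assume pos: "positive T"
  define D where "D x y = cinner x (app T y) - cinner (app T x) y" for x y
  have D_add: "D (x + x') y = D x y + D x' y" "D x (y + y') = D x y + D x y'" for x x' y y'
    by (simp_all add: D_def app_add cinner.add_left cinner.add_right)
  have D_sc: "D (c *\<^sub>C x) y = cnj c * D x y" "D x (c *\<^sub>C y) = c * D x y" for c x y
    by (simp_all add: D_def app_scaleC cinner_scaleC_left cinner_scaleC_right right_diff_distrib)
  have diag: "D x x = 0" for x
  proof -
    have "Im (cinner x (app T x)) = 0"
      using pos by (simp add: positive_def complex_nonneg_Reals_iff)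
    moreover have "cinner (app T x) x = cnj (cinner x (app T x))"
      by (rule cinner_commute)
    ultimately show ?thesis
      by (simp add: D_def complex_eq_iff)
  qed
  have "D x y = 0" for x y
  proof -
    have "D x y + D y x = 0"
      using diag[of "x + y"] diag[of x] diag[of y] by (simp add: D_add add.commute)
    moreover have "\<i> * D x y - \<i> * D y x = 0"
      using diag[of "x + \<i> *\<^sub>C y"] diag[of x] diag[of y] by (simp add: D_add D_sc)
    ultimately show ?thesis
      by (simp add: add_eq_0_iff2)
  qed
  then have "adj T = T"
    by (intro adj_eqI) (simp add: D_def)
  with pos show "adj T = T \<and> (\<forall>x. 0 \<le> Re (cinner x (app T x)))"
    by (simp add: positive_def complex_nonneg_Reals_iff)
next
  assume T: "adj T = T \<and> (\<forall>x. 0 \<le> Re (cinner x (app T x)))"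
  have "Im (cinner x (app T x)) = 0" for x
  proof -
    have "cinner x (app T x) = cnj (cinner x (app T x))"
      using T cinner_adj_left[of T x x] cinner_commute[of x "app T x"] by simp
    then show ?thesis by (simp add: complex_eq_iff)
  qed
  with T show "positive T"
    by (simp add: positive_def complex_nonneg_Reals_iff)
qed

lemma positive_adj_eq: "positive T \<Longrightarrow> adj T = T"
  by (simp add: positive_iff_adj)

lemma positive_Re: "positive T \<Longrightarrow> 0 \<le> Re (cinner x (app T x))"
  by (simp add: positive_iff_adj)

lemma positive_add: "positive S \<Longrightarrow> positive T \<Longrightarrow> positive (S + T)"
  by (simp add: positive_iff_adj app_simps cinner.add_right)

lemma positive_scale: "0 \<le> r \<Longrightarrow> positive T \<Longrightarrow> positive (complex_of_real r *\<^sub>C T)"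
  by (simp add: positive_iff_adj app_simps cinner_scaleC_right)

lemma positive_conj: "positive T \<Longrightarrow> positive (adj S * T * S)"
  by (simp add: positive_iff_adj app_simps cinner_adj_right mult.assoc)

lemma positive_one: "positive (1 :: 'h::complex_hilbert_space bop)"
  by (simp add: positive_iff_adj app_simps Re_cinner_self)

lemma positive_adj_mult_self: "positive (adj S * S)"
  using positive_conj[OF positive_one, of S] by simp

lemma norm_app_sq: "(norm (app S x))\<^sup>2 = Re (cinner x (app (adj S * S) x))"
  by (simp add: app_simps cinner_adj_right Re_cinner_self)

text \<open>\<open>norm_app_sq\<close> expresses the norm of \<open>app S (app R x)\<close> through
  \<open>adj S * S\<close>. With \<open>R = 1 - p\<close> this passes from
  \<open>h * h * p = h * h\<close> to \<open>h * p = h\<close>.\<close>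

lemma adj_mult_cancel: "adj S * S * R = 0 \<Longrightarrow> S * R = 0"
proof (rule bop_eqI)
  fix x assume "adj S * S * R = 0"
  then have "app (adj S * S * R) x = app 0 x" by simp
  then have "app (adj S * S) (app R x) = 0"
    by (simp only: times_bop.rep_eq zero_bop.rep_eq)
  then have "(norm (app S (app R x)))\<^sup>2 = 0"
    by (simp add: norm_app_sq cinner.zero_right)
  then show "app (S * R) x = app 0 x"
    by (simp add: app_simps)
qed

lemma positive_diff_of_bound:
  assumes "adj S = S" and "\<And>x. Re (cinner x (app S x)) \<le> C * (norm x)\<^sup>2"
  shows "positive (complex_of_real C *\<^sub>C 1 - S)"
  using assms by (simp add: positive_iff_adj app_simps cinner.diff_right cinner_scaleC_right Re_cinner_self)

text \<open>The uniform bound makes multiplication sequentially continuous in both factors jointly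
  and dominates the series that define the ultraweak topology.\<close>

definition bounded_strong_limit ::
    "(nat \<Rightarrow> 'h::complex_hilbert_space bop) \<Rightarrow> 'h bop \<Rightarrow> bool" where
  "bounded_strong_limit X x \<longleftrightarrow>
     (\<exists>C. \<forall>n \<xi>. norm (app (X n) \<xi>) \<le> C * norm \<xi>) \<and> (\<forall>\<xi>. (\<lambda>n. app (X n) \<xi>) \<longlonglongrightarrow> app x \<xi>)"

lemma bounded_strong_limit_const: "bounded_strong_limit (\<lambda>_. x) x"
  using app_bound_ex[of x] by (auto simp: bounded_strong_limit_def)

lemma bounded_strong_limit_add:
  assumes "bounded_strong_limit X x" "bounded_strong_limit Y y"
  shows "bounded_strong_limit (\<lambda>n. X n + Y n) (x + y)"
proof -
  obtain C D where CD: "\<And>n \<xi>. norm (app (X n) \<xi>) \<le> C * norm \<xi>" "\<And>n \<xi>. norm (app (Y n) \<xi>) \<le> D * norm \<xi>"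
    using assms unfolding bounded_strong_limit_def by blast
  have "norm (app (X n + Y n) \<xi>) \<le> (C + D) * norm \<xi>" for n \<xi>
    using norm_triangle_mono[OF CD] by (simp add: app_simps distrib_right)
  then show ?thesis
    using assms unfolding bounded_strong_limit_def by (auto simp: app_simps intro: tendsto_add)
qed

lemma bounded_strong_limit_mult:
  assumes "bounded_strong_limit X x" "bounded_strong_limit Y y"
  shows "bounded_strong_limit (\<lambda>n. X n * Y n) (x * y)"
proof -
  obtain C D where C: "\<And>n \<xi>. norm (app (X n) \<xi>) \<le> C * norm \<xi>"
    and D: "\<And>n \<xi>. norm (app (Y n) \<xi>) \<le> D * norm \<xi>"
    using assms unfolding bounded_strong_limit_def by blast
  have C': "norm (app (X n) \<xi>) \<le> \<bar>C\<bar> * norm \<xi>" for n \<xi>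
    using C[of n \<xi>] by (rule order_trans) (simp add: mult_right_mono)
  have "norm (app (X n * Y n) \<xi>) \<le> (\<bar>C\<bar> * D) * norm \<xi>" for n \<xi>
    using C'[of n "app (Y n) \<xi>"] mult_left_mono[OF D[of n \<xi>], of "\<bar>C\<bar>"]
    by (simp add: app_simps mult.assoc)
  moreover have "(\<lambda>n. app (X n * Y n) \<xi>) \<longlonglongrightarrow> app (x * y) \<xi>" for \<xi>
  proof -
    have "(\<lambda>n. app (Y n) \<xi>) \<longlonglongrightarrow> app y \<xi>"
      using assms(2) by (simp add: bounded_strong_limit_def)
    then have "(\<lambda>n. \<bar>C\<bar> * norm (app (Y n) \<xi> - app y \<xi>)) \<longlonglongrightarrow> 0"
      using tendsto_mult_right_zero tendsto_norm_zero LIM_zero by blast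
    then have "(\<lambda>n. app (X n) (app (Y n) \<xi> - app y \<xi>)) \<longlonglongrightarrow> 0"
      by (rule Lim_null_comparison[rotated]) (simp add: C')
    moreover have "(\<lambda>n. app (X n) (app y \<xi>)) \<longlonglongrightarrow> app x (app y \<xi>)"
      using assms(1) by (simp add: bounded_strong_limit_def)
    ultimately have "(\<lambda>n. app (X n) (app (Y n) \<xi> - app y \<xi>) + app (X n) (app y \<xi>))
        \<longlonglongrightarrow> 0 + app x (app y \<xi>)"
      by (rule tendsto_add)
    then show ?thesis by (simp add: app_simps app_diff)
  qed
  ultimately show ?thesis
    unfolding bounded_strong_limit_def by blast
qed

lemma bounded_strong_limit_diff:
  assumes "bounded_strong_limit X x" "bounded_strong_limit Y y"
  shows "bounded_strong_limit (\<lambda>n. X n - Y n) (x - y)"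
  using bounded_strong_limit_add[OF assms(1)
      bounded_strong_limit_mult[OF bounded_strong_limit_const[of "-1"] assms(2)]]
  by simp

lemma bounded_strong_limit_Suc:
  assumes "bounded_strong_limit X x"
  shows "bounded_strong_limit (\<lambda>n. X (Suc n)) x"
  using assms unfolding bounded_strong_limit_def
  by (intro conjI allI LIMSEQ_Suc[where f = "\<lambda>n. app (X n) _"]) blast+

lemma bounded_strong_limit_unique:
  "bounded_strong_limit X x \<Longrightarrow> bounded_strong_limit X y \<Longrightarrow> x = y"
  unfolding bounded_strong_limit_def by (metis LIMSEQ_unique bop_eqI)

lemma bounded_strong_limit_exists:
  assumes C: "\<And>n \<xi>. norm (app (X n) \<xi>) \<le> C * norm \<xi>"
    and conv: "\<And>\<xi>. convergent (\<lambda>n. app (X n) \<xi>)"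
  shows "\<exists>x. bounded_strong_limit X x"
proof -
  obtain f where f: "\<And>\<xi>. (\<lambda>n. app (X n) \<xi>) \<longlonglongrightarrow> f \<xi>"
    using conv unfolding convergent_def by metis
  have fadd: "f (\<xi> + \<eta>) = f \<xi> + f \<eta>" for \<xi> \<eta>
    using LIMSEQ_unique[OF f] tendsto_add[OF f f] by (simp add: app_add)
  have fsc: "f (c *\<^sub>C \<xi>) = c *\<^sub>C f \<xi>" for c \<xi>
    using LIMSEQ_unique[OF f] bounded_linear.tendsto[OF bounded_linear_scaleC f]
    by (simp add: app_scaleC)
  have fb: "norm (f \<xi>) \<le> norm \<xi> * C" for \<xi>
    using LIMSEQ_le_const2[OF tendsto_norm[OF f]] C by (metis mult.commute)
  have "bounded_linear f"
    by (rule bounded_linear_intro[of _ C]) (auto simp: fadd scaleR_scaleC fsc fb)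
  then have "app (Bop f) = f"
    by (simp add: Bop_inverse fsc)
  then have "bounded_strong_limit X (Bop f)"
    using C f unfolding bounded_strong_limit_def by auto
  then show ?thesis ..
qed

section \<open>The Newton--Schulz iteration for the polar part\<close>

text \<open>Products of commuting positive operators are positive; for polynomials in a positive
  contraction \<open>h\<close> with nonnegative coefficients in \<open>h\<close> and \<open>1 - h\<close> this needs no square root.\<close>

inductive poscone :: "'h::complex_hilbert_space bop \<Rightarrow> 'h bop \<Rightarrow> bool" for h where
  one: "poscone h 1"
| mult_left: "poscone h T \<Longrightarrow> poscone h (h * T)"
| mult_left_compl: "poscone h T \<Longrightarrow> poscone h ((1 - h) * T)"
| add: "poscone h S \<Longrightarrow> poscone h T \<Longrightarrow> poscone h (S + T)"
| scale: "0 \<le> r \<Longrightarrow> poscone h T \<Longrightarrow> poscone h (complex_of_real r *\<^sub>C T)"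

lemma poscone_mult: "poscone h S \<Longrightarrow> poscone h T \<Longrightarrow> poscone h (S * T)"
  by (induction rule: poscone.induct)
    (auto simp: mult.assoc distrib_right bop_scaleC_simps(1) intro: poscone.intros)

lemma poscone_self: "poscone h h"
  using poscone.mult_left[OF poscone.one] by simp

lemma poscone_compl: "poscone h (1 - h)"
  using poscone.mult_left_compl[OF poscone.one, of h] by simp

lemma poscone_commute: "poscone h T \<Longrightarrow> T * h = h * T"
  by (induction rule: poscone.induct)
    (auto simp: mult.assoc distrib_right distrib_left left_diff_distrib right_diff_distrib
      bop_scaleC_simps)

text \<open>Positivity of \<open>T\<close> alone does not propagate through left multiplication.
  With \<open>k = 1 - h\<close>, the induction carries \<open>T\<close>, \<open>h * T\<close>,
  \<open>k * T\<close> and \<open>h * k * T\<close> together; multiplying by \<open>h\<close> or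
  \<open>k\<close> turns each into another of the four or into a compression
  \<open>h * S * h\<close> or \<open>k * S * k\<close>.\<close>

lemma poscone_positive:
  assumes "positive h" "positive (1 - h)" "poscone h T"
  shows "positive T"
proof -
  define k where "k = 1 - h"
  have hk: "h * k = k * h"
    by (simp add: k_def algebra_simps)
  have adj: "adj h = h" "adj k = k"
    using assms by (auto simp: k_def positive_adj_eq)
  have conj: "positive (h * S * h)" "positive (k * S * k)" if "positive S" for S
    using positive_conj[OF that, of h] positive_conj[OF that, of k] adj by auto
  \<comment> \<open>Because \<open>h + k = 1\<close>, the product \<open>h * k\<close> equals
    \<open>h * k * (h + k)\<close>, a sum of two compressions of positive operators.\<close>
  have hk_eq: "h * k = h * k * h + k * h * k"
    by (simp add: k_def algebra_simps)
  have "positive T \<and> positive (h * T) \<and> positive (k * T) \<and> positive (h * k * T)"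
    using assms(3)
  proof (induction rule: poscone.induct)
    case one
    have "positive (h * k)"
      by (subst hk_eq) (use assms conj in \<open>auto simp: k_def intro: positive_add\<close>)
    then show ?case using assms positive_one by (simp add: k_def)
  next
    case (mult_left T)
    have c: "T * h = h * T" using mult_left poscone_commute by blast
    have "h * (h * T) = h * T * h" "k * (h * T) = h * k * T" "h * k * (h * T) = h * (k * T) * h"
      by (simp_all only: mult.assoc c) (simp only: hk flip: mult.assoc)
    then show ?case using mult_left conj by metis
  next
    case (mult_left_compl T)
    have c: "T * k = k * T" using mult_left_compl poscone_commute[of h T]
      by (simp add: k_def algebra_simps)
    have "h * (k * T) = h * k * T" "k * (k * T) = k * T * k" "h * k * (k * T) = k * (h * T) * k"
      by (simp_all only: mult.assoc c) (metis hk mult.assoc)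
    then show ?case using mult_left_compl conj by (metis k_def)
  qed (auto simp: distrib_left bop_scaleC_simps intro: positive_add positive_scale)
  then show ?thesis by simp
qed

abbreviation half :: "'h::complex_hilbert_space bop \<Rightarrow> 'h bop" where
  "half T \<equiv> (1/2) *\<^sub>C T"

lemma half_simps:
  "half (S + T) = half S + half T" "half (S - T) = half S - half T"
  "half S * T = half (S * T)" "S * half T = half (S * T)"
  by (simp_all only: bop_scaleC_simps)

lemma half_add_self: "half T + half T = T"
  by (simp flip: bop_scaleC_simps(9) add: bop_scaleC_simps(6))

text \<open>Lets two halves merge inside a sum nested to the right.\<close>

lemma half_add_self': "half T + (half T + S) = T + S"
  by (simp only: add.assoc[symmetric] half_add_self)

text \<open>The factor by which one iteration step shrinks the error \<open>1 - y\<close>, as an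
  operator upper bound.\<close>

abbreviation damping :: "'h::complex_hilbert_space bop \<Rightarrow> 'h bop" where
  "damping h \<equiv> 1 - half h"

text \<open>Formulated with \<open>adj\<close>, so that the same recursion runs on the scaled
  \<open>a\<close> and, as \<open>(3 y - y^3) / 2\<close>, on its self-adjoint absolute
  value.\<close>

fun newton_schulz :: "'h::complex_hilbert_space bop \<Rightarrow> nat \<Rightarrow> 'h bop" where
  "newton_schulz w 0 = w"
| "newton_schulz w (Suc n) =
     half (newton_schulz w n + newton_schulz w n + newton_schulz w n
       - newton_schulz w n * adj (newton_schulz w n) * newton_schulz w n)"

context
  fixes h :: "'h::complex_hilbert_space bop"
  assumes h: "positive h" "positive (1 - h)"
begin

lemma poscone_half: "poscone h T \<Longrightarrow> poscone h (half T)"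
  using poscone.scale[of "1/2"] by simp

lemma poscone_pow: "poscone h T \<Longrightarrow> poscone h (T ^ n)"
  by (induction n) (auto intro: poscone.one poscone_mult)

lemma poscone_adj: "poscone h T \<Longrightarrow> adj T = T"
  using poscone_positive h positive_adj_eq by blast

text \<open>The product \<open>d * (1 - d)\<close> stays in the cone, so \<open>d * d\<close> is at
  most \<open>d\<close>. This turns convergence of quadratic forms into convergence in norm.\<close>

lemma poscone_norm_sq:
  assumes "poscone h d" "poscone h (1 - d)"
  shows "(norm (app d \<xi>))\<^sup>2 \<le> Re (cinner \<xi> (app d \<xi>))"
proof -
  have "positive (d * (1 - d))"
    using assms poscone_mult poscone_positive h by blast
  then have "0 \<le> Re (cinner \<xi> (app (d * (1 - d)) \<xi>))"
    by (rule positive_Re)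
  moreover have "adj d = d" using assms poscone_adj by blast
  ultimately show ?thesis
    by (simp add: norm_app_sq right_diff_distrib app_simps cinner.diff_right)
qed

lemma poscone_norm:
  assumes "poscone h d" "poscone h (1 - d)"
  shows "norm (app d \<xi>) \<le> norm \<xi>"
proof -
  have "0 \<le> Re (cinner \<xi> (app (1 - d) \<xi>))"
    using assms poscone_positive h positive_Re by blast
  then have "Re (cinner \<xi> (app d \<xi>)) \<le> (norm \<xi>)\<^sup>2"
    by (simp add: app_simps cinner.diff_right Re_cinner_self)
  with poscone_norm_sq[OF assms, of \<xi>] have "(norm (app d \<xi>))\<^sup>2 \<le> (norm \<xi>)\<^sup>2"
    by (rule order_trans)
  then show ?thesis by (rule power2_le_imp_le) simp
qed

lemma poscone_damping: "poscone h (damping h)"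
proof -
  have "damping h = (1 - h) + half h"
    using half_add_self[of h] by (simp add: algebra_simps)
  then show ?thesis
    using poscone.add poscone_compl poscone_half poscone_self by metis
qed

text \<open>Telescoping: consecutive powers differ by \<open>damping h ^ n * half h\<close>, which
  lies in the cone.\<close>

lemma poscone_damping_diff: "m \<le> n \<Longrightarrow> poscone h (damping h ^ m - damping h ^ n)"
proof (induction n rule: dec_induct)
  case base
  have "poscone h (complex_of_real 0 *\<^sub>C 1)" by (intro poscone.intros) simp
  then show ?case by (simp add: bop_scaleC_simps)
next
  case (step n)
  have "damping h ^ m - damping h ^ Suc n = (damping h ^ m - damping h ^ n) + damping h ^ n * half h"
    by (simp only: power_Suc2) (simp add: right_diff_distrib)
  then show ?case
    using step poscone.add poscone_mult poscone_half poscone_self poscone_pow poscone_damping by metis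
qed

text \<open>Monotone convergence of operators. \<open>poscone_norm_sq\<close> for a difference of
  two powers bounds the distance of the vectors by a difference of the scalars \<open>c\<close>,
  which decrease and are bounded below.\<close>

lemma damping_limit_exists: "\<exists>Q. bounded_strong_limit (\<lambda>n. damping h ^ n) Q"
proof (rule bounded_strong_limit_exists[where C = 1])
  have compl: "poscone h (1 - damping h ^ n)" for n
    using poscone_damping_diff[of 0 n] by simp
  show "norm (app (damping h ^ n) \<xi>) \<le> 1 * norm \<xi>" for n \<xi>
    using poscone_norm[OF poscone_pow[OF poscone_damping] compl] by simp
  fix \<xi>
  define c where "c n = Re (cinner \<xi> (app (damping h ^ n) \<xi>))" for n
  have bound: "(norm (app (damping h ^ m) \<xi> - app (damping h ^ n) \<xi>))\<^sup>2 \<le> c m - c n" if "m \<le> n" for m n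
  proof -
    have "1 - (damping h ^ m - damping h ^ n) = (1 - damping h ^ m) + damping h ^ n" by simp
    then have "poscone h (1 - (damping h ^ m - damping h ^ n))"
      using compl poscone.add poscone_pow poscone_damping by metis
    then show ?thesis
      using poscone_norm_sq[OF poscone_damping_diff[OF that], of \<xi>]
      by (simp add: c_def app_simps cinner.diff_right)
  qed
  have dec: "decseq c"
    unfolding decseq_def using bound by (meson diff_ge_0_iff_ge order_trans zero_le_power2)
  have "0 \<le> c n" for n
    unfolding c_def using positive_Re poscone_positive[OF h] poscone_pow poscone_damping by blast
  then obtain l where "c \<longlonglongrightarrow> l"
    using decseq_convergent[OF dec] by metis
  then have "Cauchy c"
    using LIMSEQ_imp_Cauchy by blast
  have "Cauchy (\<lambda>n. app (damping h ^ n) \<xi>)"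
  proof (rule CauchyI', unfold dist_norm)
    fix e :: real assume "0 < e"
    then obtain M where M: "\<And>m n. m \<ge> M \<Longrightarrow> n \<ge> M \<Longrightarrow> norm (c m - c n) < e\<^sup>2"
      using CauchyD[OF \<open>Cauchy c\<close>, of "e\<^sup>2"] by auto
    have "norm (app (damping h ^ m) \<xi> - app (damping h ^ n) \<xi>) < e" if "M \<le> m" "m < n" for m n
    proof -
      have "(norm (app (damping h ^ m) \<xi> - app (damping h ^ n) \<xi>))\<^sup>2 < e\<^sup>2"
        using bound[of m n] M[of m n] that by simp
      then show ?thesis using \<open>0 < e\<close> by (simp add: power2_less_imp_less)
    qed
    then show "\<exists>M. \<forall>m\<ge>M. \<forall>n>m. norm (app (damping h ^ m) \<xi> - app (damping h ^ n) \<xi>) < e" by blast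
  qed
  then show "convergent (\<lambda>n. app (damping h ^ n) \<xi>)"
    by (rule Cauchy_convergent)
qed

text \<open>\<open>damping h\<close> fixes the limit, so \<open>h\<close> annihilates it and all
  powers fix it; a further limit gives idempotence. \<open>Q\<close> is the projection onto the
  kernel of \<open>h\<close>.\<close>

lemma damping_limit:
  assumes Q: "bounded_strong_limit (\<lambda>n. damping h ^ n) Q"
  shows "projection Q" and "h * Q = 0"
proof -
  have "bounded_strong_limit (\<lambda>n. damping h * damping h ^ n) (damping h * Q)"
    by (intro bounded_strong_limit_mult bounded_strong_limit_const Q)
  moreover have "bounded_strong_limit (\<lambda>n. damping h ^ Suc n) Q"
    by (rule bounded_strong_limit_Suc) (rule Q)
  ultimately have TQ: "damping h * Q = Q"
    using bounded_strong_limit_unique by auto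
  then have "half (h * Q) = 0"
    by (simp add: left_diff_distrib bop_scaleC_simps(1))
  then show "h * Q = 0"
    using half_add_self[of "h * Q"] by simp
  have "damping h ^ n * Q = Q" for n
    by (induction n) (simp_all add: TQ mult.assoc)
  then have "Q * Q = Q"
    using bounded_strong_limit_mult[OF Q bounded_strong_limit_const[of Q]]
      bounded_strong_limit_const[of Q] bounded_strong_limit_unique by simp
  moreover have "adj Q = Q"
  proof (rule adj_eqI)
    fix x y
    have lim: "(\<lambda>n. app (damping h ^ n) z) \<longlonglongrightarrow> app Q z" for z
      using Q by (simp add: bounded_strong_limit_def)
    have "cinner (app (damping h ^ n) x) y = cinner x (app (damping h ^ n) y)" for n
      using cinner_adj_left poscone_adj poscone_pow poscone_damping by metis
    then show "cinner (app Q x) y = cinner x (app Q y)"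
      using cinner.tendsto[OF lim tendsto_const, of x y] cinner.tendsto[OF tendsto_const lim, of x y]
        LIMSEQ_unique by simp
  qed
  ultimately show "projection Q"
    by (simp add: projection_def)
qed

text \<open>With \<open>e = 1 - y\<close>, one step of the iteration maps \<open>e\<close> to \<open>e\<^sup>2 (3 - e) / 2\<close>, which is
  at most \<open>e * damping h\<close> because \<open>h \<le> y\<close>.\<close>

lemma newton_schulz_poscone:
  defines "y \<equiv> newton_schulz h"
  shows "poscone h (y n) \<and> poscone h (1 - y n) \<and> poscone h (y n - h) \<and> poscone h (damping h ^ n - (1 - y n))"
proof (induction n)
  case 0
  have "poscone h (complex_of_real 0 *\<^sub>C 1)" by (intro poscone.intros) simp
  then have "poscone h 0" by (simp add: bop_scaleC_simps)
  then show ?case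
    by (simp add: y_def poscone_self poscone_compl)
next
  case (Suc n)
  define z where "z = y n"
  have IH: "poscone h z" "poscone h (1 - z)" "poscone h (z - h)" "poscone h (damping h ^ n - (1 - z))"
    using Suc by (auto simp: z_def)
  have step: "y (Suc n) = half (z + z + z - z * z * z)"
    using poscone_adj[OF IH(1)] by (simp add: y_def z_def)
  have eq1: "y (Suc n) = z + half (z * ((1 - z) * (1 + z)))"
    unfolding step by (simp add: half_simps algebra_simps half_add_self half_add_self')
  have eq2: "1 - y (Suc n) = half ((1 - z) * ((1 - z) * (1 + 1 + z)))"
    unfolding step by (simp add: half_simps algebra_simps half_add_self half_add_self')
  have eq3: "y (Suc n) - h = (z - h) + half (z * ((1 - z) * (1 + z)))"
    by (simp add: eq1)
  have "half ((1 - z) * (1 + 1 + z)) = 1 - half z - half (z * z)"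
    by (simp add: half_simps algebra_simps half_add_self half_add_self')
  then have "1 - y (Suc n) = (1 - z) * (1 - half z - half (z * z))"
    by (simp add: eq2 flip: half_simps(4))
  \<comment> \<open>With \<open>T = damping h\<close>, \<open>e = 1 - z\<close> and
    \<open>s = 1 - half z - half (z * z)\<close>, the new error is \<open>e * s\<close>, and
    \<open>T ^ Suc n - e * s = (T ^ n - e) * T + e * (T - s)\<close>. Here \<open>T - s\<close> is
    in the cone because \<open>z - h\<close> is.\<close>
  then have eq4: "damping h ^ Suc n - (1 - y (Suc n)) =
      (damping h ^ n - (1 - z)) * damping h + (1 - z) * (half (z - h) + half (z * z))"
    by (simp only: power_Suc2) (simp add: half_simps algebra_simps half_add_self half_add_self')
  have c: "poscone h (1 + z)" "poscone h (1 + 1 + z)"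
    using IH(1) by (intro poscone.add poscone.one; simp)+
  have "poscone h (y (Suc n))"
    unfolding eq1 by (intro poscone.add poscone_half poscone_mult IH c)
  moreover have "poscone h (1 - y (Suc n))"
    unfolding eq2 by (intro poscone_half poscone_mult IH c)
  moreover have "poscone h (y (Suc n) - h)"
    unfolding eq3 by (intro poscone.add poscone_half poscone_mult IH c)
  moreover have "poscone h (damping h ^ Suc n - (1 - y (Suc n)))"
    unfolding eq4 by (intro poscone.add poscone_half poscone_mult IH poscone_damping)
  ultimately show ?case by blast
qed

end

text \<open>The iterates started at the scaled \<open>a\<close> are \<open>v * y n\<close>, with
  \<open>y n\<close> those of the scaled absolute value. Both limits thus follow from
  \<open>y n\<close> tending strongly to \<open>p = adj v * v\<close>, since
  \<open>v * p = v\<close> and \<open>p * adj v = adj v\<close>.\<close>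

lemma newton_schulz_tendsto_polar_part:
  assumes "polar_decomposition a v h"
  obtains r where
    "bounded_strong_limit (newton_schulz (complex_of_real r *\<^sub>C a)) v"
    "bounded_strong_limit (\<lambda>n. adj (newton_schulz (complex_of_real r *\<^sub>C a) n)) (adj v)"
proof -
  define p where "p = adj v * v"
  have h: "positive h" and hh: "h * h = adj a * a" and a: "a = v * h" and "projection p"
    and support: "is_support_projection (adj a * a) p"
    using assms unfolding polar_decomposition_def partial_isometry_def p_def by blast+
  have p: "adj p = p" "p * p = p"
    using \<open>projection p\<close> by (simp_all add: projection_def)
  have hhp: "h * h * p = h * h"
    and minimal: "\<And>q. projection q \<Longrightarrow> h * h * q = h * h \<Longrightarrow> positive (q - p)"
    using support by (simp_all only: is_support_projection_def hh)
  have hp: "h * p = h"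
  proof -
    have "adj h * h * (1 - p) = 0"
      using hhp positive_adj_eq[OF h] by (simp add: right_diff_distrib)
    then have "h * (1 - p) = 0" by (rule adj_mult_cancel)
    then show ?thesis by (simp add: right_diff_distrib)
  qed
  have vp: "v * p = v"
  proof -
    have "adj v * v * (1 - p) = 0"
      using p by (simp add: right_diff_distrib flip: p_def)
    then have "v * (1 - p) = 0" by (rule adj_mult_cancel)
    then show ?thesis by (simp add: right_diff_distrib)
  qed
  obtain M where M: "M > 0" "\<And>x. norm (app h x) \<le> M * norm x"
    using app_bound_ex by blast
  \<comment> \<open>Dividing by a bound for \<open>h\<close> gives a positive contraction;
    \<open>1 / M\<close> is the scalar \<open>r\<close> to be produced.\<close>
  define k where "k = complex_of_real (1 / M) *\<^sub>C h"
  have k: "positive k"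
    unfolding k_def using M h by (intro positive_scale) auto
  have "positive (complex_of_real 1 *\<^sub>C 1 - k)"
  proof (rule positive_diff_of_bound)
    show "adj k = k" using k by (rule positive_adj_eq)
    fix x
    have "Re (cinner x (app h x)) \<le> norm x * norm (app h x)"
      using Cauchy_Schwarz complex_Re_le_cmod order_trans by blast
    also have "\<dots> \<le> norm x * (M * norm x)"
      by (intro mult_left_mono M) simp
    finally show "Re (cinner x (app k x)) \<le> 1 * (norm x)\<^sup>2"
      using M(1) by (simp add: k_def app_simps cinner_scaleC_right field_simps power2_eq_square)
  qed
  then have k1: "positive (1 - k)" by (simp add: bop_scaleC_simps(6))
  have h_eq: "h = complex_of_real M *\<^sub>C k"
    using M(1) by (simp add: k_def bop_scaleC_simps(5,6))
  have kp: "k * p = k"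
    by (simp add: k_def bop_scaleC_simps(1) hp)
  define y where "y = newton_schulz k"
  define w where "w = newton_schulz (complex_of_real (1 / M) *\<^sub>C a)"
  note cone = newton_schulz_poscone[OF k k1, folded y_def]
  have adj_y: "adj (y n) = y n" for n
    using cone poscone_adj[OF k k1] by blast
  have yp: "y n * p = y n" for n
    by (induction n) (simp_all add: y_def kp half_simps distrib_right left_diff_distrib mult.assoc)
  have py: "p * y n = y n" for n
    using arg_cong[OF yp, of adj n] by (simp add: p adj_y)
  have wy: "w n = v * y n" for n
  proof (induction n)
    case 0
    then show ?case by (simp add: w_def y_def k_def a bop_scaleC_simps(2))
  next
    case (Suc n)
    \<comment> \<open>The inner \<open>adj v * v\<close> is \<open>p\<close>, which
      \<open>y n\<close> absorbs, so the cubic term becomes \<open>v\<close> times the cube of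
      \<open>y n\<close>.\<close>
    have "v * y n * (y n * adj v) * (v * y n) = v * y n * y n * (p * y n)"
      by (simp add: p_def mult.assoc)
    then show ?case
      using Suc adj_y[of n]
      by (simp add: w_def y_def half_simps py[unfolded y_def] distrib_left right_diff_distrib mult.assoc)
  qed
  let ?T = "damping k"
  obtain Q where Q: "bounded_strong_limit (\<lambda>n. ?T ^ n) Q"
    using damping_limit_exists[OF k k1] by blast
  have adjQ: "adj Q = Q" and QQ: "Q * Q = Q" and kQ: "k * Q = 0"
    using damping_limit[OF k k1 Q] by (auto simp: projection_def)
  \<comment> \<open>The projection \<open>1 - Q\<close> also satisfies
    \<open>h * h * (1 - Q) = h * h\<close>, so minimality yields \<open>p \<le> 1 - Q\<close>.
    Compressing by \<open>Q\<close> shows that \<open>- (Q * p * Q)\<close> is positive, which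
    forces \<open>p * Q = 0\<close>.\<close>
  have Qp: "Q * p = 0"
  proof -
    have "projection (1 - Q)"
      using adjQ QQ by (simp add: projection_def algebra_simps)
    moreover have "h * h * (1 - Q) = h * h"
      using kQ by (simp add: h_eq right_diff_distrib bop_scaleC_simps mult.assoc)
    ultimately have "positive (1 - Q - p)"
      by (rule minimal)
    then have "positive (adj Q * (1 - Q - p) * Q)"
      by (rule positive_conj)
    moreover have "adj Q * (1 - Q - p) * Q = - (Q * p * Q)"
      by (simp add: adjQ QQ right_diff_distrib left_diff_distrib mult.assoc)
    moreover have "Q * p * Q = adj (p * Q) * (p * Q)"
      by (simp add: adjQ p mult.assoc) (metis p(2) mult.assoc)
    ultimately have neg: "positive (- (adj (p * Q) * (p * Q)))" by simp
    have "p * Q = 0"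
    proof (rule bop_eqI)
      fix x
      have "(norm (app (p * Q) x))\<^sup>2 \<le> 0"
        using positive_Re[OF neg, of x] by (simp only: norm_app_sq) (simp add: app_simps cinner.minus_right)
      then show "app (p * Q) x = app 0 x" by (simp add: app_simps)
    qed
    from arg_cong[OF this, of adj] show ?thesis by (simp add: adjQ p)
  qed
  have "bounded_strong_limit y p"
    unfolding bounded_strong_limit_def
  proof (intro conjI exI allI)
    show "norm (app (y n) \<xi>) \<le> 1 * norm \<xi>" for n \<xi>
      using poscone_norm[OF k k1] cone by simp
    fix \<xi>
    \<comment> \<open>Since \<open>y n * p = y n\<close>, only vectors in the range of
      \<open>p\<close> matter. \<open>Q\<close> vanishes there, and \<open>1 - y n\<close> is
      squeezed between 0 and \<open>?T ^ n\<close>.\<close>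
    define \<eta> where "\<eta> = app p \<xi>"
    have "app Q \<eta> = 0"
      unfolding \<eta>_def by (metis Qp times_bop.rep_eq zero_bop.rep_eq)
    moreover have "(\<lambda>n. Re (cinner \<eta> (app (?T ^ n) \<eta>))) \<longlonglongrightarrow> Re (cinner \<eta> (app Q \<eta>))"
      using Q unfolding bounded_strong_limit_def by (intro tendsto_intros cinner.tendsto) auto
    ultimately have lim: "(\<lambda>n. Re (cinner \<eta> (app (?T ^ n) \<eta>))) \<longlonglongrightarrow> 0"
      by (simp add: cinner.zero_right)
    have "norm ((norm (app (1 - y n) \<eta>))\<^sup>2) \<le> Re (cinner \<eta> (app (?T ^ n) \<eta>))" for n
    proof -
      have "poscone k (1 - (1 - y n))" using cone by simp
      then have "(norm (app (1 - y n) \<eta>))\<^sup>2 \<le> Re (cinner \<eta> (app (1 - y n) \<eta>))"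
        using poscone_norm_sq[OF k k1] cone by blast
      also have "\<dots> \<le> Re (cinner \<eta> (app (?T ^ n) \<eta>))"
        using positive_Re[OF poscone_positive[OF k k1], of "?T ^ n - (1 - y n)" \<eta>] cone
        by (simp add: app_simps cinner.diff_right)
      finally show ?thesis by simp
    qed
    then have "(\<lambda>n. (norm (app (1 - y n) \<eta>))\<^sup>2) \<longlonglongrightarrow> 0"
      by (intro Lim_null_comparison[OF _ lim]) simp
    then have "(\<lambda>n. app (1 - y n) \<eta>) \<longlonglongrightarrow> 0"
      by (simp add: tendsto_norm_zero_iff)
    then have "(\<lambda>n. \<eta> - app (1 - y n) \<eta>) \<longlonglongrightarrow> \<eta> - 0"
      by (intro tendsto_diff tendsto_const)
    moreover have "\<eta> - app (1 - y n) \<eta> = app (y n) \<xi>" for n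
      using yp[of n] by (simp add: \<eta>_def app_simps) (metis times_bop.rep_eq)
    ultimately show "(\<lambda>n. app (y n) \<xi>) \<longlonglongrightarrow> app p \<xi>"
      by (simp add: \<eta>_def)
  qed
  moreover have "w = (\<lambda>n. v * y n)" "(\<lambda>n. adj (w n)) = (\<lambda>n. y n * adj v)"
    using wy by (auto simp: adj_y)
  moreover have "p * adj v = adj v"
    using arg_cong[OF vp, of adj] by (simp add: p)
  ultimately have "bounded_strong_limit w v" "bounded_strong_limit (\<lambda>n. adj (w n)) (adj v)"
    using bounded_strong_limit_mult[OF bounded_strong_limit_const]
      bounded_strong_limit_mult[OF _ bounded_strong_limit_const] vp by metis+
  then show ?thesis
    using that unfolding w_def by blast
qed

section \<open>Continuity of the conditional expectation\<close>

lemma norm_adj_bound: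
  assumes "\<And>\<xi>. norm (app S \<xi>) \<le> C * norm \<xi>"
  shows "norm (app (adj S) \<xi>) \<le> C * norm \<xi>"
proof (cases "app (adj S) \<xi> = 0")
  case True
  have "0 \<le> C * norm \<xi>"
    using assms[of \<xi>] norm_ge_zero order_trans by blast
  with True show ?thesis by simp
next
  case False
  have "norm (app (adj S) \<xi>) * norm (app (adj S) \<xi>) = Re (cinner \<xi> (app S (app (adj S) \<xi>)))"
    by (metis Re_cinner_commute Re_cinner_self cinner_adj_left power2_eq_square)
  also have "\<dots> \<le> norm \<xi> * norm (app S (app (adj S) \<xi>))"
    using Cauchy_Schwarz complex_Re_le_cmod order_trans by blast
  also have "\<dots> \<le> norm \<xi> * (C * norm (app (adj S) \<xi>))"
    by (intro mult_left_mono assms) simp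
  finally have "norm (app (adj S) \<xi>) * norm (app (adj S) \<xi>) \<le> (C * norm \<xi>) * norm (app (adj S) \<xi>)"
    by (simp add: ac_simps)
  then show ?thesis
    using False by simp
qed

section \<open>Bounded strong, ultraweak and weak convergence\<close>

lemma topspace_ultraweak [simp]:
  "topspace (ultraweak_topology :: 'h::complex_hilbert_space bop topology) = UNIV"
proof -
  have "square_summable (\<lambda>_. 0 :: 'h)"
    by (simp add: square_summable_def)
  then have "(UNIV :: 'h bop set) \<in> {{T. (\<Sum>n. cinner (\<xi> n) (app T (\<eta> n))) \<in> U} | \<xi> \<eta> U.
        square_summable \<xi> \<and> square_summable \<eta> \<and> open U}"
    by (intro CollectI exI[of _ "\<lambda>_. 0"] exI[of _ UNIV]) auto
  then show ?thesis
    unfolding ultraweak_topology_def topology_generated_by_topspace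
    by (intro subset_antisym subset_UNIV Union_upper)
qed

text \<open>Eventual membership passes to finite intersections and to unions, so subbasic sets
  suffice.\<close>

lemma limitin_topology_generated_by:
  assumes "l \<in> \<Union>\<S>" and "\<And>U. U \<in> \<S> \<Longrightarrow> l \<in> U \<Longrightarrow> eventually (\<lambda>n. f n \<in> U) F"
  shows "limitin (topology_generated_by \<S>) f l F"
proof -
  have "l \<in> U \<longrightarrow> eventually (\<lambda>n. f n \<in> U) F" if "generate_topology_on \<S> U" for U
    using that
  proof induction
    case (Int a b)
    then show ?case by (auto elim: eventually_elim2)
  next
    case (UN K)
    show ?case
    proof
      assume "l \<in> \<Union>K"
      then obtain k where "k \<in> K" "l \<in> k" by blast
      with UN have "eventually (\<lambda>n. f n \<in> k) F" by blast
      then show "eventually (\<lambda>n. f n \<in> \<Union>K) F"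
        by (rule eventually_mono) (use \<open>k \<in> K\<close> in blast)
    qed
  qed (use assms in auto)
  with assms(1) show ?thesis
    by (auto simp: limitin_def openin_topology_generated_by_iff)
qed

text \<open>Dominated convergence for series: Cauchy-Schwarz and the uniform bound dominate the
  terms by the summable \<open>M\<close>, while strong convergence handles each term.\<close>

lemma limitin_ultraweak:
  assumes "bounded_strong_limit X x"
  shows "limitin ultraweak_topology X x sequentially"
  unfolding ultraweak_topology_def
proof (rule limitin_topology_generated_by, goal_cases)
  case 1
  have "x \<in> topspace ultraweak_topology" by simp
  then show ?case
    unfolding ultraweak_topology_def topology_generated_by_topspace .
next
  case (2 W)
  then obtain \<xi> \<eta> U where W: "W = {T. (\<Sum>n. cinner (\<xi> n) (app T (\<eta> n))) \<in> U}"
    and ss: "square_summable \<xi>" "square_summable \<eta>" and "open U"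
    by blast
  obtain C where C: "\<And>n \<zeta>. norm (app (X n) \<zeta>) \<le> C * norm \<zeta>"
    using assms unfolding bounded_strong_limit_def by blast
  have C': "norm (app (X n) \<zeta>) \<le> \<bar>C\<bar> * norm \<zeta>" for n \<zeta>
    using C[of n \<zeta>] by (rule order_trans) (simp add: mult_right_mono)
  define M where "M k = \<bar>C\<bar> * ((norm (\<xi> k))\<^sup>2 + (norm (\<eta> k))\<^sup>2)" for k
  have "norm (cinner (\<xi> k) (app (X n) (\<eta> k))) \<le> M k" for k n
  proof -
    have "norm (cinner (\<xi> k) (app (X n) (\<eta> k))) \<le> norm (\<xi> k) * norm (app (X n) (\<eta> k))"
      by (rule Cauchy_Schwarz)
    also have "\<dots> \<le> norm (\<xi> k) * (\<bar>C\<bar> * norm (\<eta> k))"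
      by (intro mult_left_mono C') simp
    also have "\<dots> = \<bar>C\<bar> * (norm (\<xi> k) * norm (\<eta> k))"
      by simp
    also have "\<dots> \<le> M k"
    proof -
      have "0 \<le> (norm (\<xi> k) - norm (\<eta> k))\<^sup>2" "0 \<le> norm (\<xi> k) * norm (\<eta> k)" by simp_all
      then have "norm (\<xi> k) * norm (\<eta> k) \<le> (norm (\<xi> k))\<^sup>2 + (norm (\<eta> k))\<^sup>2"
        unfolding power2_diff by linarith
      then show ?thesis unfolding M_def by (intro mult_left_mono) auto
    qed
    finally show ?thesis .
  qed
  moreover have "summable M"
    using ss unfolding M_def square_summable_def by (intro summable_mult summable_add)
  moreover have "(\<lambda>n. cinner (\<xi> k) (app (X n) (\<eta> k))) \<longlonglongrightarrow> cinner (\<xi> k) (app x (\<eta> k))" for k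
    using assms by (intro cinner.tendsto tendsto_const) (simp add: bounded_strong_limit_def)
  ultimately have "(\<lambda>n. \<Sum>k. cinner (\<xi> k) (app (X n) (\<eta> k))) \<longlonglongrightarrow> (\<Sum>k. cinner (\<xi> k) (app x (\<eta> k)))"
    using tannerys_theorem[of "\<lambda>k n. cinner (\<xi> k) (app (X n) (\<eta> k))"
        "\<lambda>k. cinner (\<xi> k) (app x (\<eta> k))" sequentially M]
    by (simp add: always_eventually case_prod_unfold)
  moreover have "(\<Sum>k. cinner (\<xi> k) (app x (\<eta> k))) \<in> U"
    using 2(2) by (simp add: W)
  ultimately have "eventually (\<lambda>n. (\<Sum>k. cinner (\<xi> k) (app (X n) (\<eta> k))) \<in> U) sequentially"
    using \<open>open U\<close> by (intro topological_tendstoD)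
  then show ?case by (simp add: W)
qed

lemma limitin_ultraweak_imp_weak:
  fixes X :: "nat \<Rightarrow> 'h::complex_hilbert_space bop"
  assumes "limitin ultraweak_topology X x sequentially"
  shows "(\<lambda>n. cinner \<xi> (app (X n) \<eta>)) \<longlonglongrightarrow> cinner \<xi> (app x \<eta>)"
proof (rule topological_tendstoI)
  fix U :: "complex set"
  assume U: "open U" "cinner \<xi> (app x \<eta>) \<in> U"
  \<comment> \<open>Families concentrated at index 0 reduce the ultraweak functional to one matrix
    coefficient.\<close>
  define \<delta> where "\<delta> \<zeta> k = (if k = (0::nat) then \<zeta> else 0)" for \<zeta> :: 'h and k
  have ss: "square_summable (\<delta> \<zeta>)" for \<zeta>
    unfolding square_summable_def \<delta>_def by (rule summable_finite[of "{0}"]) auto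
  have sum: "(\<Sum>k. cinner (\<delta> \<xi> k) (app T (\<delta> \<eta> k))) = cinner \<xi> (app T \<eta>)" for T
    using suminf_finite[of "{0}" "\<lambda>k. cinner (\<delta> \<xi> k) (app T (\<delta> \<eta> k))"]
    by (auto simp: \<delta>_def cinner.zero_left)
  have "openin ultraweak_topology {T. (\<Sum>k. cinner (\<delta> \<xi> k) (app T (\<delta> \<eta> k))) \<in> U}"
    unfolding ultraweak_topology_def
    by (rule topology_generated_by_Basis) (use ss U in blast)
  then have "openin ultraweak_topology {T. cinner \<xi> (app T \<eta>) \<in> U}"
    by (simp only: sum)
  then have "eventually (\<lambda>n. X n \<in> {T. cinner \<xi> (app T \<eta>) \<in> U}) sequentially"
    using assms U unfolding limitin_def by blast
  then show "eventually (\<lambda>n. cinner \<xi> (app (X n) \<eta>) \<in> U) sequentially"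
    by simp
qed

section \<open>Closure properties of the algebras and basic properties of the expectation\<close>

lemma commutant_closed:
  shows "1 \<in> commutant M" "0 \<in> commutant M"
    and "S \<in> commutant M \<Longrightarrow> T \<in> commutant M \<Longrightarrow> S + T \<in> commutant M"
    and "S \<in> commutant M \<Longrightarrow> T \<in> commutant M \<Longrightarrow> S * T \<in> commutant M"
    and "S \<in> commutant M \<Longrightarrow> c *\<^sub>C S \<in> commutant M"
  by (auto simp: commutant_def distrib_left distrib_right bop_scaleC_simps)
    (metis mult.assoc)

text \<open>A von Neumann algebra is the commutant of its commutant, so this keeps bounded strong
  limits inside \<open>A\<close>.\<close>

lemma commutant_limit:
  assumes "\<And>n. X n \<in> commutant M" and "bounded_strong_limit X x"
  shows "x \<in> commutant M"
  unfolding commutant_def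
proof (intro CollectI ballI)
  fix S assume "S \<in> M"
  then have "(\<lambda>n. X n * S) = (\<lambda>n. S * X n)"
    using assms(1) by (simp add: commutant_def)
  then show "x * S = S * x"
    using bounded_strong_limit_mult[OF assms(2) bounded_strong_limit_const[of S]]
      bounded_strong_limit_mult[OF bounded_strong_limit_const[of S] assms(2)]
      bounded_strong_limit_unique by metis
qed

locale W_probability_space =
  fixes B A :: "'h::complex_hilbert_space bop set" and E :: "'h bop \<Rightarrow> 'h bop"
  assumes W: "W_noncommutative_probability_space B A E"
begin

lemma
  shows one_in_B: "1 \<in> B"
    and B_mult: "S \<in> B \<Longrightarrow> T \<in> B \<Longrightarrow> S * T \<in> B"
    and B_adj: "S \<in> B \<Longrightarrow> adj S \<in> B"
    and B_subset_A: "B \<subseteq> A"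
    and zero_in_A: "0 \<in> A"
    and A_add: "S \<in> A \<Longrightarrow> T \<in> A \<Longrightarrow> S + T \<in> A"
    and A_mult: "S \<in> A \<Longrightarrow> T \<in> A \<Longrightarrow> S * T \<in> A"
    and A_scale: "S \<in> A \<Longrightarrow> c *\<^sub>C S \<in> A"
    and A_adj: "S \<in> A \<Longrightarrow> adj S \<in> A"
    and A_limit: "(\<And>n. X n \<in> A) \<Longrightarrow> bounded_strong_limit X x \<Longrightarrow> x \<in> A"
  using W commutant_closed[where M = "commutant B"] commutant_closed[where M = "commutant A"]
    commutant_limit[of X "commutant A"]
  unfolding W_noncommutative_probability_space_def von_neumann_algebra_def by auto

lemma A_diff: "S \<in> A \<Longrightarrow> T \<in> A \<Longrightarrow> S - T \<in> A"
  using A_add A_scale[of T "-1"] by (metis diff_conv_add_uminus minus_bop_eq_scaleC)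

lemma
  shows E_in_B: "x \<in> A \<Longrightarrow> E x \<in> B"
    and E_positive: "x \<in> A \<Longrightarrow> positive x \<Longrightarrow> positive (E x)"
    and E_adj: "x \<in> A \<Longrightarrow> E (adj x) = adj (E x)"
    and E_add: "x \<in> A \<Longrightarrow> y \<in> A \<Longrightarrow> E (x + y) = E x + E y"
    and E_scale: "x \<in> A \<Longrightarrow> E (c *\<^sub>C x) = c *\<^sub>C E x"
    and E_id: "b \<in> B \<Longrightarrow> E b = b"
    and E_bimodule: "b \<in> B \<Longrightarrow> b' \<in> B \<Longrightarrow> x \<in> A \<Longrightarrow> E (b * x * b') = b * E x * b'"
    and E_normal: "normal_map A B E"
  using W unfolding W_noncommutative_probability_space_def conditional_expectation_def by blast+

lemma E_in_A: "x \<in> A \<Longrightarrow> E x \<in> A"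
  using E_in_B B_subset_A by blast

lemma E_diff: "x \<in> A \<Longrightarrow> y \<in> A \<Longrightarrow> E (x - y) = E x - E y"
  using E_add[of x "(-1) *\<^sub>C y"] A_scale[of y "-1"] E_scale[of y "-1"]
  by (simp flip: minus_bop_eq_scaleC)

lemma E_mult_right: "x \<in> A \<Longrightarrow> b \<in> B \<Longrightarrow> E (x * b) = E x * b"
  using E_bimodule[of 1 b x] one_in_B by simp

lemma E_mult_left: "x \<in> A \<Longrightarrow> b \<in> B \<Longrightarrow> E (b * x) = b * E x"
  using E_bimodule[of b 1 x] one_in_B by simp

lemma E_zero: "E 0 = 0"
  using E_scale[OF zero_in_A, of 0] by (simp add: bop_scaleC_simps)

text \<open>Apply positivity of \<open>E\<close> to \<open>adj (x - E x) * (x - E x)\<close>; by the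
  bimodule property each cross term has expectation \<open>adj (E x) * E x\<close>.\<close>

lemma E_Schwarz:
  assumes "x \<in> A"
  shows "positive (E (adj x * x) - adj (E x) * E x)"
proof -
  have in_A: "adj x \<in> A" "E x \<in> A" "adj (E x) \<in> A" "E x \<in> B" "adj (E x) \<in> B"
    using assms A_adj E_in_A E_in_B B_adj by blast+
  have "positive (E (adj (x - E x) * (x - E x)))"
    using assms in_A by (intro E_positive positive_adj_mult_self A_mult A_adj A_diff)
  moreover have "adj (x - E x) * (x - E x) =
      adj x * x - adj x * E x - (adj (E x) * x - adj (E x) * E x)"
    by (simp add: algebra_simps)
  ultimately show ?thesis
    using assms in_A
    by (simp add: E_diff E_mult_left E_mult_right E_id E_adj A_mult A_diff B_mult)
qed

lemma E_norm_sq: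
  assumes "x \<in> A"
  shows "(norm (app (E x) \<xi>))\<^sup>2 \<le> Re (cinner \<xi> (app (E (adj x * x)) \<xi>))"
  using positive_Re[OF E_Schwarz[OF assms], of \<xi>]
  by (simp add: norm_app_sq minus_bop.rep_eq cinner.diff_right)

text \<open>Applying normality to \<open>\<bar>X n - x\<bar>\<^sup>2\<close> upgrades ultraweak to strong convergence, thanks
  to the Schwarz inequality for \<open>E\<close>.\<close>

lemma E_limit:
  assumes X: "\<And>n. X n \<in> A" and lim: "bounded_strong_limit X x"
  shows "bounded_strong_limit (\<lambda>n. E (X n)) (E x)"
proof -
  have xA: "x \<in> A"
    using assms by (rule A_limit)
  define D where "D n = X n - x" for n
  have DA: "D n \<in> A" for n
    using X xA A_diff by (simp add: D_def)
  have "bounded_strong_limit D 0"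
    using bounded_strong_limit_diff[OF lim bounded_strong_limit_const[of x]] by (simp add: D_def[abs_def])
  then obtain C where C: "\<And>n \<xi>. norm (app (D n) \<xi>) \<le> C * norm \<xi>"
    and D0: "\<And>\<xi>. (\<lambda>n. app (D n) \<xi>) \<longlonglongrightarrow> 0"
    by (auto simp: bounded_strong_limit_def zero_bop.rep_eq)
  define Y where "Y n = adj (D n) * D n" for n
  have YA: "Y n \<in> A" for n
    using DA A_mult A_adj by (simp add: Y_def)
  have C_adj: "norm (app (adj (D n)) \<xi>) \<le> \<bar>C\<bar> * norm \<xi>" for n \<xi>
    using norm_adj_bound[of "D n" C \<xi>] C mult_right_mono[of C "\<bar>C\<bar>" "norm \<xi>"]
    by (meson abs_ge_self norm_ge_zero order_trans)
  have Y_bound: "norm (app (Y n) \<xi>) \<le> \<bar>C\<bar> * norm (app (D n) \<xi>)" for n \<xi>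
    using C_adj by (simp add: Y_def times_bop.rep_eq)
  have "bounded_strong_limit Y 0"
    unfolding bounded_strong_limit_def zero_bop.rep_eq
  proof (intro conjI exI allI)
    show "norm (app (Y n) \<xi>) \<le> (\<bar>C\<bar> * C) * norm \<xi>" for n \<xi>
      using Y_bound[of n \<xi>] mult_left_mono[OF C[of n \<xi>], of "\<bar>C\<bar>"] by simp
    show "(\<lambda>n. app (Y n) \<xi>) \<longlonglongrightarrow> 0" for \<xi>
    proof (rule Lim_null_comparison[OF always_eventually, rule_format, OF Y_bound])
      show "(\<lambda>n. \<bar>C\<bar> * norm (app (D n) \<xi>)) \<longlonglongrightarrow> 0"
        using tendsto_mult_right_zero[OF tendsto_norm_zero[OF D0]] by blast
    qed
  qed
  then have "limitin (subtopology ultraweak_topology A) Y 0 sequentially"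
    using YA zero_in_A limitin_ultraweak by (auto simp: limitin_subtopology)
  then have "limitin (subtopology ultraweak_topology B) (E \<circ> Y) (E 0) sequentially"
    using E_normal unfolding normal_map_def by (metis continuous_map_limit)
  then have EY: "(\<lambda>n. cinner \<xi> (app (E (Y n)) \<xi>)) \<longlonglongrightarrow> 0" for \<xi>
    using limitin_ultraweak_imp_weak[of "E \<circ> Y" 0 \<xi> \<xi>]
    by (simp add: limitin_subtopology E_zero zero_bop.rep_eq cinner.zero_right o_def)
  have "bounded_strong_limit (\<lambda>n. E (D n)) 0"
    unfolding bounded_strong_limit_def zero_bop.rep_eq
  proof (intro conjI exI allI)
    fix n \<xi>
    \<comment> \<open>The uniform bound: \<open>Y n\<close> is at most \<open>C^2\<close>, and since
      \<open>E\<close> is positive and fixes scalars, so is \<open>E (Y n)\<close>.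
      \<open>E_norm_sq\<close> then bounds \<open>E (D n)\<close>.\<close>
    have "Re (cinner \<zeta> (app (Y n) \<zeta>)) \<le> C\<^sup>2 * (norm \<zeta>)\<^sup>2" for \<zeta>
      using power_mono[OF C[of n \<zeta>], of 2] by (simp add: Y_def norm_app_sq[symmetric] power_mult_distrib)
    then have "positive (complex_of_real (C\<^sup>2) *\<^sub>C 1 - Y n)"
      by (intro positive_diff_of_bound) (simp_all add: Y_def)
    then have "positive (E (complex_of_real (C\<^sup>2) *\<^sub>C 1 - Y n))"
      using YA one_in_B B_subset_A by (intro E_positive A_diff A_scale) auto
    then have "positive (complex_of_real (C\<^sup>2) *\<^sub>C 1 - E (Y n))"
      using YA one_in_B B_subset_A A_scale
      by (subst (asm) E_diff) (auto simp: E_scale E_id subset_iff)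
    from positive_Re[OF this, of \<xi>]
    have "Re (cinner \<xi> (app (E (Y n)) \<xi>)) \<le> C\<^sup>2 * (norm \<xi>)\<^sup>2"
      by (simp add: app_simps cinner.diff_right cinner_scaleC_right Re_cinner_self)
    with E_norm_sq[OF DA[of n], of \<xi>] have "(norm (app (E (D n)) \<xi>))\<^sup>2 \<le> (\<bar>C\<bar> * norm \<xi>)\<^sup>2"
      by (simp add: Y_def power_mult_distrib)
    then show "norm (app (E (D n)) \<xi>) \<le> \<bar>C\<bar> * norm \<xi>"
      by (rule power2_le_imp_le) simp
  next
    fix \<xi>
    have "(\<lambda>n. Re (cinner \<xi> (app (E (Y n)) \<xi>))) \<longlonglongrightarrow> 0"
      using tendsto_Re[OF EY] by simp
    then have "(\<lambda>n. (norm (app (E (D n)) \<xi>))\<^sup>2) \<longlonglongrightarrow> 0"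
      by (rule Lim_null_comparison[rotated])
        (use E_norm_sq[OF DA, of _ \<xi>] in \<open>simp add: Y_def\<close>)
    then show "(\<lambda>n. app (E (D n)) \<xi>) \<longlonglongrightarrow> 0"
      by (simp add: tendsto_norm_zero_iff)
  qed
  then have "bounded_strong_limit (\<lambda>n. E (D n) + E x) (0 + E x)"
    by (intro bounded_strong_limit_add bounded_strong_limit_const)
  then show ?thesis
    using X xA by (simp add: D_def E_diff)
qed

end

section \<open>Alternating words and chains of centered words\<close>

text \<open>\<open>e\<close> and \<open>f\<close> are the first and last exponents. Every letter,
  also the last one, carries a coefficient on its right, as in \<open>block_product\<close>.\<close>

inductive altword ::
    "'h::complex_hilbert_space bop set \<Rightarrow> 'h bop \<Rightarrow> exponent \<Rightarrow> exponent \<Rightarrow> 'h bop \<Rightarrow> bool"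
  for B c where
  single: "b \<in> B \<Longrightarrow> altword B c e e (starpow c e * b)"
| cons: "b \<in> B \<Longrightarrow> e \<noteq> e' \<Longrightarrow> altword B c e' f x \<Longrightarrow> altword B c e f (starpow c e * b * x)"

text \<open>The exponent \<open>f\<close> shared by consecutive words makes them the blocks of the maximal
  alternating interval partition.\<close>

inductive chain ::
    "'h::complex_hilbert_space bop set \<Rightarrow> ('h bop \<Rightarrow> 'h bop) \<Rightarrow> 'h bop \<Rightarrow> exponent \<Rightarrow> 'h bop \<Rightarrow> bool"
  for B E c where
  single: "altword B c e f x \<Longrightarrow> chain B E c e (x - E x)"
| cons: "altword B c e f x \<Longrightarrow> chain B E c f z \<Longrightarrow> chain B E c e ((x - E x) * z)"

text \<open>The two families of moments in \<open>R_diagonal\<close> without index sets: the odd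
  moments are the words from \<open>One\<close> to \<open>One\<close>, the centered ones are the
  chains.\<close>

definition chain_vanishing ::
    "'h::complex_hilbert_space bop set \<Rightarrow> ('h bop \<Rightarrow> 'h bop) \<Rightarrow> 'h bop \<Rightarrow> bool" where
  "chain_vanishing B E c \<longleftrightarrow>
     (\<forall>x. altword B c One One x \<longrightarrow> E x = 0) \<and> (\<forall>e z. chain B E c e z \<longrightarrow> E z = 0)"

inductive lspan :: "('h::complex_hilbert_space bop \<Rightarrow> bool) \<Rightarrow> 'h bop \<Rightarrow> bool" for P where
  base: "P x \<Longrightarrow> lspan P x"
| add: "lspan P x \<Longrightarrow> lspan P y \<Longrightarrow> lspan P (x + y)"
| scale: "lspan P x \<Longrightarrow> lspan P (r *\<^sub>C x)"

context W_probability_space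
begin

lemma starpow_in_A: "c \<in> A \<Longrightarrow> starpow c e \<in> A"
  by (cases e) (auto intro: A_adj)

lemma altword_in_A: "altword B c e f x \<Longrightarrow> c \<in> A \<Longrightarrow> x \<in> A"
  by (induction rule: altword.induct) (use B_subset_A in \<open>auto intro!: A_mult starpow_in_A\<close>)

lemma chain_in_A: "chain B E c e z \<Longrightarrow> c \<in> A \<Longrightarrow> z \<in> A"
  by (induction rule: chain.induct) (blast intro: A_mult A_diff E_in_A altword_in_A)+

text \<open>\<open>E\<close> is linear only on \<open>A\<close>, hence so is \<open>F\<close>; the
  induction therefore carries membership in \<open>A\<close> along.\<close>

lemma lspan_map:
  assumes "lspan P x" and "\<And>x. P x \<Longrightarrow> x \<in> A" and "\<And>x. P x \<Longrightarrow> lspan Q (F x)"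
    and add: "\<And>x y. x \<in> A \<Longrightarrow> y \<in> A \<Longrightarrow> F (x + y) = F x + F y"
    and scale: "\<And>r x. x \<in> A \<Longrightarrow> F (r *\<^sub>C x) = r *\<^sub>C F x"
  shows "lspan Q (F x)"
proof -
  have "x \<in> A \<and> lspan Q (F x)"
    using assms(1)
    by induction (use assms in \<open>auto simp: A_add A_scale intro: lspan.add lspan.scale\<close>)
  then show ?thesis ..
qed

lemma lspan_in_A: "lspan P x \<Longrightarrow> (\<And>x. P x \<Longrightarrow> x \<in> A) \<Longrightarrow> x \<in> A"
  by (induction rule: lspan.induct) (auto intro: A_add A_scale)

lemma lspan_E_zero:
  assumes "lspan P x" and "\<And>x. P x \<Longrightarrow> x \<in> A" and "\<And>x. P x \<Longrightarrow> E x = 0"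
  shows "E x = 0"
proof -
  have "x \<in> A \<and> E x = 0"
    using assms(1)
    by induction (use assms in \<open>auto simp: A_add A_scale E_add E_scale bop_scaleC_simps\<close>)
  then show ?thesis ..
qed

text \<open>Substituting a combination of \<open>c\<close> and \<open>c c\<^sup>* c\<close> for \<open>c\<close> changes neither the alternation
  nor the first and last exponent of a word.\<close>

lemma altword_substitute:
  assumes c: "c \<in> A"
    and w: "w = complex_of_real \<alpha> *\<^sub>C c + complex_of_real \<beta> *\<^sub>C (c * adj c * c)"
    and x: "altword B w e f x"
  shows "lspan (altword B c e f) x"
proof -
  have prepend: "lspan (altword B c e f) (starpow c e * b * x)"
    if "b \<in> B" "e \<noteq> e'" "lspan (altword B c e' f) x" for b e e' f x
    by (rule lspan_map[OF that(3)])
      (use that c in \<open>auto simp: distrib_left bop_scaleC_simps intro: altword_in_A lspan.base altword.cons\<close>)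
  \<comment> \<open>A letter with exponent \<open>e\<close> is exchanged for itself or for three
    letters with exponents \<open>e\<close>, \<open>e'\<close>, \<open>e\<close>, the new inner
    coefficients being 1. As \<alpha> and \<beta> are real, \<open>adj w\<close> has the same form
    in \<open>adj c\<close>, which covers both exponents.\<close>
  have replace: "lspan (altword B c e f) (starpow w e * y)"
    if "lspan (altword B c e f) (starpow c e * y)" for e f y
  proof -
    obtain e' where e': "e' \<noteq> e" and "starpow w e = complex_of_real \<alpha> *\<^sub>C starpow c e
        + complex_of_real \<beta> *\<^sub>C (starpow c e * (starpow c e' * starpow c e))"
      by (cases e) (fastforce simp: w mult.assoc)+
    then have "starpow w e * y = complex_of_real \<alpha> *\<^sub>C (starpow c e * y)
        + complex_of_real \<beta> *\<^sub>C (starpow c e * 1 * (starpow c e' * 1 * (starpow c e * y)))"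
      by (simp add: distrib_right bop_scaleC_simps mult.assoc)
    then show ?thesis
      using that e' one_in_B
      by (auto intro!: lspan.add lspan.scale prepend[of _ e e'] prepend[of _ e' e] simp del: mult_1_right)
  qed
  show ?thesis
    using x
  proof induction
    case (single b e)
    then show ?case
      by (intro replace lspan.base altword.single)
  next
    case (cons b e e' f x)
    then show ?case
      using replace[of e f "b * x"] prepend[of b e e' f x] by (simp add: mult.assoc)
  qed
qed

text \<open>Centering is linear, so a chain is multilinear in its words and each word can be
  expanded separately. The links between words persist because the expansion keeps both end
  exponents.\<close>

lemma chain_substitute:
  assumes c: "c \<in> A"
    and w: "w = complex_of_real \<alpha> *\<^sub>C c + complex_of_real \<beta> *\<^sub>C (c * adj c * c)"
    and z: "chain B E w e z"
  shows "lspan (chain B E c e) z"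
  using z
proof induction
  case (single e f x)
  show ?case
    by (rule lspan_map[OF altword_substitute[OF c w single]])
      (use c in \<open>auto simp: E_add E_scale bop_scaleC_simps intro: altword_in_A lspan.base chain.single\<close>)
next
  case (cons e f x z)
  have zA: "z \<in> A"
    using cons.IH chain_in_A c lspan_in_A by blast
  show ?case
  proof (rule lspan_map[OF altword_substitute[OF c w cons.hyps(1)], where F = "\<lambda>x. (x - E x) * z"])
    fix y assume y: "altword B c e f y"
    then show "y \<in> A" using c altword_in_A by blast
    show "lspan (chain B E c e) ((y - E y) * z)"
      by (rule lspan_map[OF cons.IH])
        (use c y in \<open>auto simp: distrib_left bop_scaleC_simps intro: chain_in_A lspan.base chain.cons\<close>)
  qed (auto simp: E_add E_scale bop_scaleC_simps algebra_simps)
qed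

lemma chain_vanishing_substitute:
  assumes c: "c \<in> A" and van: "chain_vanishing B E c"
    and w: "w = complex_of_real \<alpha> *\<^sub>C c + complex_of_real \<beta> *\<^sub>C (c * adj c * c)"
  shows "w \<in> A" and "chain_vanishing B E w"
proof -
  show "w \<in> A"
    unfolding w using c by (intro A_add A_scale A_mult A_adj)
  show "chain_vanishing B E w"
    unfolding chain_vanishing_def
  proof (intro conjI allI impI)
    fix x assume "altword B w One One x"
    then have "lspan (altword B c One One) x" by (rule altword_substitute[OF c w])
    then show "E x = 0"
      by (rule lspan_E_zero) (use van c altword_in_A in \<open>auto simp: chain_vanishing_def\<close>)
  next
    fix e z assume "chain B E w e z"
    then have "lspan (chain B E c e) z" by (rule chain_substitute[OF c w])
    then show "E z = 0"
      by (rule lspan_E_zero) (use van c chain_in_A in \<open>auto simp: chain_vanishing_def\<close>)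
  qed
qed

text \<open>A word or chain in \<open>v\<close> is the limit of those of the same shape in
  \<open>w n\<close>. \<open>E_limit\<close> enters twice: inside the centered factors and for the
  outer expectation.\<close>

lemma chain_vanishing_limit:
  assumes wA: "\<And>n. w n \<in> A" and van: "\<And>n. chain_vanishing B E (w n)"
    and w: "bounded_strong_limit w v"
    and w_adj: "bounded_strong_limit (\<lambda>n. adj (w n)) (adj v)"
  shows "chain_vanishing B E v"
proof -
  have starpow: "bounded_strong_limit (\<lambda>n. starpow (w n) e) (starpow v e)" for e
    using w w_adj by (cases e) auto
  have alt: "\<exists>X. (\<forall>n. altword B (w n) e f (X n)) \<and> bounded_strong_limit X x"
    if "altword B v e f x" for e f x
    using that
  proof induction
    case (single b e)
    then show ?case
      by (intro exI[of _ "\<lambda>n. starpow (w n) e * b"] conjI allI altword.single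
          bounded_strong_limit_mult starpow bounded_strong_limit_const)
  next
    case (cons b e e' f x)
    then obtain X where X: "\<And>n. altword B (w n) e' f (X n)" "bounded_strong_limit X x" by blast
    show ?case
      by (intro exI[of _ "\<lambda>n. starpow (w n) e * b * X n"] conjI allI altword.cons[where e' = e']
          bounded_strong_limit_mult starpow bounded_strong_limit_const X cons.hyps)
  qed
  have centered: "bounded_strong_limit (\<lambda>n. X n - E (X n)) (x - E x)"
    if "\<And>n. altword B (w n) e f (X n)" "bounded_strong_limit X x" for e f X x
    by (intro bounded_strong_limit_diff E_limit that(2) altword_in_A[OF that(1)] wA)
  have ch: "\<exists>Z. (\<forall>n. chain B E (w n) e (Z n)) \<and> bounded_strong_limit Z z"
    if "chain B E v e z" for e z
    using that
  proof induction
    case (single e f x)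
    then obtain X where X: "\<And>n. altword B (w n) e f (X n)" "bounded_strong_limit X x"
      using alt by blast
    show ?case
      by (intro exI[of _ "\<lambda>n. X n - E (X n)"] conjI allI chain.single[OF X(1)] centered[OF X])
  next
    case (cons e f x z)
    then obtain X Z where X: "\<And>n. altword B (w n) e f (X n)" "bounded_strong_limit X x"
      and Z: "\<And>n. chain B E (w n) f (Z n)" "bounded_strong_limit Z z"
      using alt by blast
    show ?case
      by (intro exI[of _ "\<lambda>n. (X n - E (X n)) * Z n"] conjI allI chain.cons[OF X(1) Z(1)]
          bounded_strong_limit_mult centered[OF X] Z)
  qed
  have zero: "E x = 0" if "bounded_strong_limit X x" "\<And>n. X n \<in> A" "\<And>n. E (X n) = 0" for X x
    using bounded_strong_limit_unique[OF E_limit[OF that(2,1)], of 0] that(3)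
      bounded_strong_limit_const[of 0] by simp
  show ?thesis
    unfolding chain_vanishing_def
  proof (intro conjI allI impI)
    fix x assume "altword B v One One x"
    then obtain X where X: "\<And>n. altword B (w n) One One (X n)" "bounded_strong_limit X x"
      using alt by blast
    show "E x = 0"
      using van X(1) unfolding chain_vanishing_def by (intro zero[OF X(2) altword_in_A[OF X(1) wA]]) blast
  next
    fix e z assume "chain B E v e z"
    then obtain Z where Z: "\<And>n. chain B E (w n) e (Z n)" "bounded_strong_limit Z z"
      using ch by blast
    show "E z = 0"
      using van Z(1) unfolding chain_vanishing_def by (intro zero[OF Z(2) chain_in_A[OF Z(1) wA]]) blast
  qed
qed

lemma chain_vanishing_polar_part:
  assumes a: "a \<in> A" "chain_vanishing B E a" and "polar_decomposition a v h"
  shows "v \<in> A \<and> chain_vanishing B E v"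
proof -
  obtain r where r: "bounded_strong_limit (newton_schulz (complex_of_real r *\<^sub>C a)) v"
    "bounded_strong_limit (\<lambda>n. adj (newton_schulz (complex_of_real r *\<^sub>C a) n)) (adj v)"
    using newton_schulz_tendsto_polar_part[OF assms(3)] .
  define w where "w = newton_schulz (complex_of_real r *\<^sub>C a)"
  have "w n \<in> A \<and> chain_vanishing B E (w n)" for n
  proof (induction n)
    case 0
    \<comment> \<open>Rescaling \<open>a\<close> is the substitution without cubic term.\<close>
    have "w 0 = complex_of_real r *\<^sub>C a + complex_of_real 0 *\<^sub>C (a * adj a * a)"
      by (simp add: w_def bop_scaleC_simps)
    then show ?case using chain_vanishing_substitute[OF a] by blast
  next
    case (Suc n)
    have "T + T + T = 3 *\<^sub>C T" for T :: "'h bop"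
      using bop_scaleC_simps(9)[of 2 1 T] bop_scaleC_simps(9)[of 1 1 T] by (simp add: bop_scaleC_simps(6))
    moreover have "half (S - T) = half S + (-1/2) *\<^sub>C T" for S T :: "'h bop"
      using bop_scaleC_simps(5)[of "-1" "1/2" T]
      by (simp add: bop_scaleC_simps(4) flip: minus_bop_eq_scaleC)
    ultimately have "w (Suc n) = complex_of_real (3/2) *\<^sub>C w n + complex_of_real (-1/2) *\<^sub>C (w n * adj (w n) * w n)"
      by (simp add: w_def bop_scaleC_simps(5))
    then show ?case using chain_vanishing_substitute Suc by blast
  qed
  then show ?thesis
    using A_limit[of w v] chain_vanishing_limit[of w v] r by (simp add: w_def)
qed

end

section \<open>Maximal alternating interval partitions\<close>

definition alternating :: "(exponent \<times> 'x) list \<Rightarrow> bool" where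
  "alternating r \<longleftrightarrow> r \<noteq> [] \<and> successively (\<lambda>p q. fst p \<noteq> fst q) r"

text \<open>Equal exponents at each junction are what makes the runs maximal.\<close>

definition runs :: "(exponent \<times> 'x) list list \<Rightarrow> bool" where
  "runs rs \<longleftrightarrow> (\<forall>r\<in>set rs. alternating r) \<and> successively (\<lambda>r s. fst (last r) = fst (hd s)) rs"

text \<open>The index sets occupied by the runs when letters are numbered from \<open>k\<close>
  on.\<close>

fun blocks :: "nat \<Rightarrow> 'x list list \<Rightarrow> nat set list" where
  "blocks k [] = []"
| "blocks k (r # rs) = {k..<k + length r} # blocks (k + length r) rs"

definition word :: "'h::complex_hilbert_space bop \<Rightarrow> (exponent \<times> 'h bop) list \<Rightarrow> 'h bop" where
  "word c r = prod_list (map (\<lambda>(e, b). starpow c e * b) r)"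

lemma alternating_Cons:
  "alternating (p # r) \<longleftrightarrow> r = [] \<or> fst p \<noteq> fst (hd r) \<and> alternating r"
  by (cases r) (auto simp: alternating_def)

lemma runs_Cons:
  "runs (r # rs) \<longleftrightarrow> alternating r \<and> (rs = [] \<or> fst (last r) = fst (hd (hd rs)) \<and> runs rs)"
  by (cases rs) (auto simp: runs_def)

text \<open>Built from the right: a new letter opens its own run if its exponent equals the next
  one, and otherwise extends the first run.\<close>

lemma runs_exist: "ws \<noteq> [] \<Longrightarrow> \<exists>rs. rs \<noteq> [] \<and> runs rs \<and> concat rs = ws"
proof (induction ws rule: list_nonempty_induct)
  case (single x)
  show ?case
    by (intro exI[of _ "[[x]]"]) (simp add: runs_Cons alternating_Cons)
next
  case (cons x ws)
  then obtain r rs where rs: "runs (r # rs)" "concat (r # rs) = ws"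
    by (metis list.exhaust)
  then have r: "r \<noteq> []" "hd r = hd ws"
    by (auto simp: runs_Cons alternating_def)
  show ?case
  proof (cases "fst x = fst (hd ws)")
    case True
    then have "runs ([x] # r # rs)"
      using rs r by (simp add: runs_Cons alternating_Cons)
    then show ?thesis using rs(2) by (intro exI[of _ "[x] # r # rs"]) auto
  next
    case False
    then have "runs ((x # r) # rs)"
      using rs r by (simp add: runs_Cons alternating_Cons)
    then show ?thesis using rs(2) by (intro exI[of _ "(x # r) # rs"]) auto
  qed
qed

lemma blocks_lower: "V \<in> set (blocks k rs) \<Longrightarrow> x \<in> V \<Longrightarrow> k \<le> x"
  by (induction rs arbitrary: k) fastforce+

lemma blocks_Min:
  assumes "runs rs" shows "sorted_wrt (<) (map Min (blocks k rs)) \<and> (\<forall>V\<in>set (blocks k rs). k \<le> Min V)"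
  using assms
proof (induction rs arbitrary: k)
  case (Cons r rs)
  have "r \<noteq> []" using Cons.prems by (auto simp: runs_Cons alternating_def)
  then have "Min {k..<k + length r} = k"
    by (intro Min_eqI) auto
  moreover have "runs rs"
    using Cons.prems by (auto simp: runs_def successively_Cons)
  ultimately show ?case
    using Cons.IH[of "k + length r"] \<open>r \<noteq> []\<close>
    by (auto intro: less_le_trans[of k "k + length r"])
qed simp

lemma blocks_alternating:
  assumes "runs rs" and "\<And>j. j < length (concat rs) \<Longrightarrow> fst (concat rs ! j) = \<epsilon> (k + j)"
    and "V \<in> set (blocks k rs)"
  shows "\<exists>l u. k \<le> l \<and> l \<le> u \<and> u < k + length (concat rs) \<and> V = {l..u} \<and>
      (\<forall>j. l \<le> j \<and> j < u \<longrightarrow> \<epsilon> j \<noteq> \<epsilon> (j + 1))"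
  using assms
proof (induction rs arbitrary: k)
  case (Cons r rs)
  have r: "alternating r" "r \<noteq> []" and rs: "runs rs"
    using Cons.prems(1) by (auto simp: runs_def alternating_def successively_Cons)
  show ?case
  proof (cases "V = {k..<k + length r}")
    case True
    have "\<epsilon> j \<noteq> \<epsilon> (j + 1)" if "k \<le> j" "j < k + length r - 1" for j
    proof -
      have "fst (r ! (j - k)) \<noteq> fst (r ! Suc (j - k))"
        using r that by (simp add: alternating_def successively_conv_nth)
      moreover have "j - k < length r" "Suc (j - k) < length r"
        using that by linarith+
      ultimately show ?thesis
        using Cons.prems(2)[of "j - k"] Cons.prems(2)[of "Suc (j - k)"] that(1)
        by (simp add: nth_append)
    qed
    moreover have "{k..<k + length r} = {k..k + length r - 1}"
      using r by (cases r) auto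
    ultimately show ?thesis
      using r True by (intro exI[of _ k] exI[of _ "k + length r - 1"]) (cases r, auto)
  next
    case False
    have "fst (concat rs ! j) = \<epsilon> (k + length r + j)" if "j < length (concat rs)" for j
      using Cons.prems(2)[of "length r + j"] that by (simp add: nth_append add.assoc)
    then obtain l u where "k + length r \<le> l" "l \<le> u" "u < k + length r + length (concat rs)"
      "V = {l..u}" "\<forall>j. l \<le> j \<and> j < u \<longrightarrow> \<epsilon> j \<noteq> \<epsilon> (j + 1)"
      using Cons.IH[OF rs, of "k + length r"] Cons.prems(3) False by auto
    then show ?thesis
      by (intro exI[of _ l] exI[of _ u]) auto
  qed
qed simp

lemma alternating_subset_block:
  assumes "runs rs" and "\<And>j. j < length (concat rs) \<Longrightarrow> fst (concat rs ! j) = \<epsilon> (k + j)"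
    and "k \<le> l" "l \<le> u" "u < k + length (concat rs)"
    and "\<And>j. l \<le> j \<Longrightarrow> j < u \<Longrightarrow> \<epsilon> j \<noteq> \<epsilon> (j + 1)"
  shows "\<exists>V\<in>set (blocks k rs). {l..u} \<subseteq> V"
  using assms
proof (induction rs arbitrary: k)
  case (Cons r rs)
  have r: "r \<noteq> []" and rs: "runs rs"
    using Cons.prems(1) by (auto simp: runs_def alternating_def successively_Cons)
  have tl: "fst (concat rs ! j) = \<epsilon> (k + length r + j)" if "j < length (concat rs)" for j
    using Cons.prems(2)[of "length r + j"] that by (simp add: nth_append add.assoc)
  consider "u < k + length r" | "k + length r \<le> l" | "l < k + length r" "k + length r \<le> u"
    by linarith
  then show ?case
  proof cases
    case 1
    then have "{l..u} \<subseteq> {k..<k + length r}" using Cons.prems(3) by auto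
    then show ?thesis by simp
  next
    case 2
    have "\<exists>V\<in>set (blocks (k + length r) rs). {l..u} \<subseteq> V"
      by (rule Cons.IH[OF rs tl 2]) (use Cons.prems in auto)
    then show ?thesis by auto
  next
    \<comment> \<open>The interval would contain \<open>k + length r - 1\<close> and its successor,
      the two sides of a junction, where the exponents agree.\<close>
    case 3
    have "length (concat (r # rs)) = length r + length (concat rs)" by simp
    then have "length (concat rs) \<noteq> 0" using 3 Cons.prems(5) by linarith
    then have "concat rs \<noteq> []" by (metis list.size(3))
    then have "rs \<noteq> []" "hd rs \<noteq> []"
      using rs by (cases rs; auto simp: runs_def alternating_def)+
    then have hd: "concat rs ! 0 = hd (hd rs)"
      by (cases rs) (auto simp: nth_append hd_conv_nth)
    have "fst (last r) = fst (hd (hd rs))"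
      using Cons.prems(1) \<open>rs \<noteq> []\<close> by (simp add: runs_Cons)
    moreover have "fst (last r) = \<epsilon> (k + length r - 1)"
      using Cons.prems(2)[of "length r - 1"] r by (cases r) (auto simp: nth_append last_conv_nth)
    moreover have "fst (hd (hd rs)) = \<epsilon> (k + length r)"
      using tl[of 0] hd \<open>concat rs \<noteq> []\<close> by simp
    ultimately have "\<epsilon> (k + length r - 1) = \<epsilon> (k + length r - 1 + 1)"
      using r by (cases r) auto
    moreover have "l \<le> k + length r - 1" "k + length r - 1 < u"
      using 3 by linarith+
    ultimately show ?thesis
      using Cons.prems(6) by blast
  qed
qed simp

lemma blocks_disjoint: "V \<in> set (blocks k rs) \<Longrightarrow> W \<in> set (blocks k rs) \<Longrightarrow> x \<in> V \<Longrightarrow> x \<in> W \<Longrightarrow> V = W"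
proof (induction rs arbitrary: k)
  case (Cons r rs)
  have "\<not> x < k + length r" if "U \<in> set (blocks (k + length r) rs)" "x \<in> U" for U
    using blocks_lower[OF that] by simp
  moreover have "x < k + length r" if "x \<in> {k..<k + length r}"
    using that by simp
  ultimately show ?case
    using Cons.prems Cons.IH[of "k + length r"]
    by (simp only: blocks.simps list.set insert_iff) metis
qed simp

text \<open>A key such as \<open>Min\<close> is injective only on particular families, so the
  folding locale is instantiated at \<open>set xs\<close> alone.\<close>

lemma (in linorder) sorted_key_list_of_set_eqI:
  assumes "sorted_wrt (<) (map f xs)"
  shows "sorted_key_list_of_set f (set xs) = xs"
proof -
  have xs: "sorted (map f xs)" "distinct (map f xs)"
    using assms by (simp_all add: strict_sorted_iff)
  interpret folding_insort_key "(\<le>)" "(<)" "set xs" f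
    by unfold_locales (use xs in \<open>simp add: distinct_map\<close>)
  show ?thesis
    using xs by (intro idem_if_sorted_distinct) (simp_all add: distinct_map)
qed

text \<open>Blocks are alternating intervals, every alternating interval lies in some block, and
  distinct blocks are disjoint; hence the maximal intervals are exactly the blocks. Their minima
  increase along the list, which settles the order.\<close>

lemma sorted_max_alternating_partition:
  assumes rs: "runs rs" and n: "n = length (concat rs)"
    and \<epsilon>: "\<And>j. j < n \<Longrightarrow> fst (concat rs ! j) = \<epsilon> (1 + j)"
  shows "sorted_key_list_of_set Min (max_alternating_partition n \<epsilon>) = blocks 1 rs"
proof -
  have alt: "alternating_interval n \<epsilon> W \<longleftrightarrow>
      (\<exists>l u. 1 \<le> l \<and> l \<le> u \<and> u < 1 + n \<and> W = {l..u} \<and> (\<forall>j. l \<le> j \<and> j < u \<longrightarrow> \<epsilon> j \<noteq> \<epsilon> (j + 1)))" for W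
    unfolding alternating_interval_def by (fastforce simp: less_Suc_eq_le Suc_le_eq)
  have alt_block: "alternating_interval n \<epsilon> V" "V \<noteq> {}" if "V \<in> set (blocks 1 rs)" for V
  proof -
    show "alternating_interval n \<epsilon> V"
      unfolding alt using blocks_alternating[OF rs _ that, of \<epsilon>] \<epsilon> unfolding n by blast
    then show "V \<noteq> {}" unfolding alt by auto
  qed
  have sub_block: "\<exists>V\<in>set (blocks 1 rs). W \<subseteq> V" if "alternating_interval n \<epsilon> W" for W
  proof -
    obtain l u where "1 \<le> l" "l \<le> u" "u < 1 + n" "W = {l..u}"
      "\<And>j. l \<le> j \<Longrightarrow> j < u \<Longrightarrow> \<epsilon> j \<noteq> \<epsilon> (j + 1)"
      using \<open>alternating_interval n \<epsilon> W\<close> unfolding alt by blast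
    then show ?thesis
      using alternating_subset_block[OF rs, of \<epsilon> 1 l u] \<epsilon> n by simp
  qed
  have "max_alternating_partition n \<epsilon> = set (blocks 1 rs)"
  proof (intro set_eqI iffI)
    fix V assume V: "V \<in> max_alternating_partition n \<epsilon>"
    then obtain W where "W \<in> set (blocks 1 rs)" "V \<subseteq> W"
      using sub_block[of V] by (auto simp only: max_alternating_partition_def mem_Collect_eq)
    moreover from this V have "W = V"
      using alt_block(1)[of W] by (simp only: max_alternating_partition_def mem_Collect_eq)
    ultimately show "V \<in> set (blocks 1 rs)" by simp
  next
    fix V assume V: "V \<in> set (blocks 1 rs)"
    have "W = V" if W: "alternating_interval n \<epsilon> W" "V \<subseteq> W" for W
    proof -
      obtain V' where "V' \<in> set (blocks 1 rs)" "W \<subseteq> V'"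
        using sub_block[OF W(1)] by blast
      moreover have "V = V'"
        using blocks_disjoint[OF V \<open>V' \<in> set (blocks 1 rs)\<close>] alt_block(2)[OF V] W \<open>W \<subseteq> V'\<close> by blast
      ultimately show ?thesis using W by blast
    qed
    then show "V \<in> max_alternating_partition n \<epsilon>"
      using alt_block(1)[OF V] by (simp add: max_alternating_partition_def)
  qed
  moreover have "sorted_key_list_of_set Min (set (blocks 1 rs)) = blocks 1 rs"
    using blocks_Min[OF rs] by (intro sorted_key_list_of_set_eqI) blast
  ultimately show ?thesis by simp
qed

lemma block_product_blocks:
  assumes "\<And>j. j < length (concat rs) \<Longrightarrow> concat rs ! j = (\<epsilon> (k + j), b (k + j))"
  shows "map (block_product c \<epsilon> b) (blocks k rs) = map (word c) rs"
  using assms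
proof (induction rs arbitrary: k)
  case (Cons r rs)
  have "map (\<lambda>j. starpow c (\<epsilon> j) * b j) [k..<k + length r] = map (\<lambda>(e, b). starpow c e * b) r"
  proof (rule nth_equalityI)
    fix i assume "i < length (map (\<lambda>j. starpow c (\<epsilon> j) * b j) [k..<k + length r])"
    then show "map (\<lambda>j. starpow c (\<epsilon> j) * b j) [k..<k + length r] ! i
        = map (\<lambda>(e, b). starpow c e * b) r ! i"
      using Cons.prems[of i] by (simp add: nth_append)
  qed simp
  moreover have "concat rs ! j = (\<epsilon> (k + length r + j), b (k + length r + j))"
    if "j < length (concat rs)" for j
    using Cons.prems[of "length r + j"] that by (simp add: nth_append add.assoc)
  ultimately show ?case
    using Cons.IH[of "k + length r"] by (simp add: block_product_def word_def)
qed simp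

section \<open>R-diagonality in terms of chains\<close>

lemma altword_imp_word:
  "altword B c e f x \<Longrightarrow>
     \<exists>r. alternating r \<and> snd ` set r \<subseteq> B \<and> fst (hd r) = e \<and> fst (last r) = f \<and> x = word c r"
proof (induction rule: altword.induct)
  case (single b e)
  then show ?case
    by (intro exI[of _ "[(e, b)]"]) (simp add: alternating_def word_def)
next
  case (cons b e e' f x)
  then obtain r where r: "alternating r" "snd ` set r \<subseteq> B" "fst (hd r) = e'" "fst (last r) = f" "x = word c r"
    by blast
  then have "r \<noteq> []" by (simp add: alternating_def)
  with r cons.hyps show ?case
    by (intro exI[of _ "(e, b) # r"]) (auto simp: alternating_Cons word_def mult.assoc)
qed

lemma word_imp_altword:
  assumes "alternating r" "snd ` set r \<subseteq> B"
  shows "altword B c (fst (hd r)) (fst (last r)) (word c r)"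
  using assms
proof (induction r)
  case (Cons p r)
  obtain e b where p: "p = (e, b)" by fastforce
  show ?case
  proof (cases "r = []")
    case True
    then show ?thesis using Cons.prems by (simp add: p word_def altword.single)
  next
    case False
    then have "altword B c e (fst (last r)) (starpow c e * b * word c r)"
      using Cons by (intro altword.cons) (auto simp: p alternating_Cons)
    then show ?thesis using False by (simp add: p word_def mult.assoc)
  qed
qed (simp add: alternating_def)

lemma chain_imp_runs:
  "chain B E c e z \<Longrightarrow>
     \<exists>rs. rs \<noteq> [] \<and> runs rs \<and> (\<forall>r\<in>set rs. snd ` set r \<subseteq> B) \<and> fst (hd (hd rs)) = e \<and>
       z = prod_list (map (\<lambda>x. x - E x) (map (word c) rs))"
proof (induction rule: chain.induct)
  case (single e f x)
  then obtain r where "alternating r" "snd ` set r \<subseteq> B" "fst (hd r) = e" "x = word c r"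
    using altword_imp_word by blast
  then show ?case
    by (intro exI[of _ "[r]"]) (simp add: runs_Cons)
next
  case (cons e f x z)
  then obtain r where "alternating r" "snd ` set r \<subseteq> B" "fst (hd r) = e" "fst (last r) = f" "x = word c r"
    using altword_imp_word by blast
  moreover obtain rs where "rs \<noteq> []" "runs rs" "\<forall>r\<in>set rs. snd ` set r \<subseteq> B" "fst (hd (hd rs)) = f"
    "z = prod_list (map (\<lambda>x. x - E x) (map (word c) rs))"
    using cons.IH by blast
  ultimately show ?case
    by (intro exI[of _ "r # rs"]) (auto simp: runs_Cons)
qed

lemma runs_imp_chain:
  assumes "rs \<noteq> []" "runs rs" "\<forall>r\<in>set rs. snd ` set r \<subseteq> B"
  shows "chain B E c (fst (hd (hd rs))) (prod_list (map (\<lambda>x. x - E x) (map (word c) rs)))"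
  using assms
proof (induction rs rule: list_nonempty_induct)
  case (single r)
  then have "altword B c (fst (hd r)) (fst (last r)) (word c r)"
    by (intro word_imp_altword) (auto simp: runs_Cons)
  then show ?case using chain.single by simp
next
  case (cons r rs)
  then have "altword B c (fst (hd r)) (fst (last r)) (word c r)"
    by (intro word_imp_altword) (auto simp: runs_Cons)
  moreover have "fst (last r) = fst (hd (hd rs))"
    using cons by (simp add: runs_Cons)
  moreover have "chain B E c (fst (hd (hd rs))) (prod_list (map (\<lambda>x. x - E x) (map (word c) rs)))"
    by (rule cons.IH) (use cons.hyps cons.prems in \<open>auto simp: runs_Cons\<close>)
  ultimately show ?case using chain.cons by fastforce
qed

section \<open>Odd moments as alternating words from \<open>One\<close> to
  \<open>One\<close>\<close>

definition odd_word :: "'h::complex_hilbert_space bop \<Rightarrow> (nat \<Rightarrow> 'h bop) \<Rightarrow> nat \<Rightarrow> 'h bop" where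
  "odd_word c b k = c * prod_list (map (\<lambda>i. b (2 * i + 1) * adj c * b (2 * i + 2) * c) [0..<k])"

lemma odd_word_Suc:
  "odd_word c b (Suc k) = c * b 1 * (adj c * b 2 * odd_word c (\<lambda>i. b (i + 2)) k)"
  unfolding odd_word_def map_upt_Suc by (simp add: mult.assoc numeral_2_eq_2)

lemma odd_word_cong:
  "(\<And>i. 1 \<le> i \<Longrightarrow> b i = b' i) \<Longrightarrow> odd_word c b k = odd_word c b' k"
  by (simp add: odd_word_def)

lemma altword_odd_word:
  "b\<^sub>0 \<in> B \<Longrightarrow> (\<And>i. i \<in> {1..2 * k} \<Longrightarrow> b i \<in> B) \<Longrightarrow> altword B c One One (odd_word c b k * b\<^sub>0)"
proof (induction k arbitrary: b)
  case 0
  then show ?case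
    using altword.single[of b\<^sub>0 B c One] by (simp add: odd_word_def)
next
  case (Suc k)
  have 1: "altword B c One One (odd_word c (\<lambda>i. b (i + 2)) k * b\<^sub>0)"
    by (rule Suc.IH) (use Suc.prems in auto)
  have 2: "altword B c Star One (starpow c Star * b 2 * (odd_word c (\<lambda>i. b (i + 2)) k * b\<^sub>0))"
    by (rule altword.cons[OF _ _ 1]) (use Suc.prems in auto)
  have "altword B c One One (starpow c One * b 1 *
      (starpow c Star * b 2 * (odd_word c (\<lambda>i. b (i + 2)) k * b\<^sub>0)))"
    by (rule altword.cons[OF _ _ 2]) (use Suc.prems in auto)
  then show ?case
    by (simp add: odd_word_Suc mult.assoc)
qed

text \<open>Prepending a letter switches the first exponent, so the induction must also describe
  words that begin with \<open>Star\<close>. The last coefficient \<open>b\<^sub>0\<close> is split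
  off because \<open>odd_word\<close> ends in \<open>c\<close>.\<close>

lemma altword_imp_odd_word:
  "altword B c e f x \<Longrightarrow> f = One \<Longrightarrow>
     \<exists>k b b\<^sub>0. b\<^sub>0 \<in> B \<and> (\<forall>i\<ge>1. b i \<in> B) \<and> (e = One \<longrightarrow> x = odd_word c b k * b\<^sub>0) \<and>
       (e = Star \<longrightarrow> (\<exists>b'\<in>B. x = adj c * b' * odd_word c b k * b\<^sub>0))"
proof (induction rule: altword.induct)
  case (single b e)
  then show ?case
    by (intro exI[of _ 0] exI[of _ "\<lambda>_. b"] exI[of _ b]) (simp add: odd_word_def)
next
  case (cons b' e e' f x)
  then obtain k b b\<^sub>0 where b: "b\<^sub>0 \<in> B" "\<forall>i\<ge>1. b i \<in> B" "e' = One \<Longrightarrow> x = odd_word c b k * b\<^sub>0"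
    "e' = Star \<Longrightarrow> (\<exists>b'\<in>B. x = adj c * b' * odd_word c b k * b\<^sub>0)"
    by blast
  show ?case
  proof (cases e)
    case Star
    then have "e' = One" using cons.hyps by (cases e') auto
    then show ?thesis
      using b(1,2) b(3) cons.hyps Star
      by (intro exI[of _ k] exI[of _ b] exI[of _ b\<^sub>0]) (auto simp: mult.assoc)
  next
    case One
    then have "e' = Star" using cons.hyps by (cases e') auto
    then obtain b'' where b'': "b'' \<in> B" "x = adj c * b'' * odd_word c b k * b\<^sub>0"
      using b(4) by blast
    \<comment> \<open>Two coefficients are put in front and the old ones move up by two;
      \<open>odd_word\<close> reads indices from 1 on only.\<close>
    define d where "d i = (if i = 1 then b' else if i = 2 then b'' else b (i - 2))" for i :: nat
    have "odd_word c (\<lambda>i. d (i + 2)) k = odd_word c b k"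
      by (rule odd_word_cong) (simp add: d_def)
    then have "odd_word c d (Suc k) = c * b' * (adj c * b'' * odd_word c b k)"
      by (simp add: odd_word_Suc) (simp add: d_def)
    moreover have "\<forall>i\<ge>1. d i \<in> B"
      using b(2) b''(1) cons.hyps(1) by (auto simp: d_def)
    ultimately show ?thesis
      using b(1) b''(2) One
      by (intro exI[of _ "Suc k"] exI[of _ d] exI[of _ b\<^sub>0]) (simp add: mult.assoc)
  qed
qed

context W_probability_space
begin

lemma R_diagonal_iff_chain_vanishing:
  "R_diagonal B A E c \<longleftrightarrow> c \<in> A \<and> chain_vanishing B E c"
proof (cases "c \<in> A")
  case True
  have odd: "(\<forall>k b. (\<forall>i\<in>{1..2 * k}. b i \<in> B) \<longrightarrow> E (odd_word c b k) = 0) \<longleftrightarrow>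
      (\<forall>x. altword B c One One x \<longrightarrow> E x = 0)" (is "?L \<longleftrightarrow> ?R")
  proof
    assume ?L
    show ?R
    proof (intro allI impI)
      fix x assume "altword B c One One x"
      then obtain k b b\<^sub>0 where b: "b\<^sub>0 \<in> B" "\<forall>i\<ge>1. b i \<in> B" and x: "x = odd_word c b k * b\<^sub>0"
        using altword_imp_odd_word by blast
      have "altword B c One One (odd_word c b k * 1)"
        using b one_in_B by (intro altword_odd_word) auto
      then have "odd_word c b k \<in> A"
        using altword_in_A True by simp
      \<comment> \<open>Right \<open>B\<close>-linearity takes the trailing coefficient out of
        \<open>E\<close>.\<close>
      then show "E x = 0"
        using \<open>?L\<close> b by (simp add: x E_mult_right)
    qed
  next
    assume ?R
    show ?L
      using \<open>?R\<close> altword_odd_word[OF one_in_B] by fastforce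
  qed
  have even: "(\<forall>n\<ge>1. \<forall>\<epsilon> b. (\<forall>j\<in>{1..n}. b j \<in> B) \<longrightarrow>
        E (prod_list
             (map (\<lambda>V. block_product c \<epsilon> b V - E (block_product c \<epsilon> b V))
                (sorted_key_list_of_set Min (max_alternating_partition n \<epsilon>)))) = 0) \<longleftrightarrow>
      (\<forall>e z. chain B E c e z \<longrightarrow> E z = 0)" (is "?L \<longleftrightarrow> ?R")
  proof -
    have eq: "map (\<lambda>V. block_product c \<epsilon> b V - E (block_product c \<epsilon> b V))
        (sorted_key_list_of_set Min (max_alternating_partition n \<epsilon>)) =
        map (\<lambda>x. x - E x) (map (word c) rs)"
      if "runs rs" "n = length (concat rs)" "\<And>j. j < n \<Longrightarrow> concat rs ! j = (\<epsilon> (1 + j), b (1 + j))"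
      for n \<epsilon> b rs
    proof -
      have "sorted_key_list_of_set Min (max_alternating_partition n \<epsilon>) = blocks 1 rs"
        using that by (intro sorted_max_alternating_partition) auto
      moreover have "map (block_product c \<epsilon> b) (blocks 1 rs) = map (word c) rs"
        using that by (intro block_product_blocks) auto
      ultimately show ?thesis
        by (simp flip: \<open>map (block_product c \<epsilon> b) (blocks 1 rs) = map (word c) rs\<close> del: map_map)
          (simp add: o_def)
    qed
    show ?thesis
    proof
      assume L: ?L
      show ?R
      proof (intro allI impI)
        fix e z assume "chain B E c e z"
        then obtain rs where rs: "rs \<noteq> []" "runs rs" "\<forall>r\<in>set rs. snd ` set r \<subseteq> B"
          and z: "z = prod_list (map (\<lambda>x. x - E x) (map (word c) rs))"
          using chain_imp_runs by blast
        define n where "n = length (concat rs)"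
        have "n \<ge> 1"
          using rs by (cases rs) (auto simp: n_def runs_Cons alternating_def Suc_le_eq)
        \<comment> \<open>List positions start at 0, exponents and coefficients at 1.\<close>
        define \<epsilon> b where "\<epsilon> j = fst (concat rs ! (j - 1))" and "b j = snd (concat rs ! (j - 1))" for j
        have "b j \<in> B" if "j \<in> {1..n}" for j
        proof -
          have "concat rs ! (j - 1) \<in> set (concat rs)"
            using that by (intro nth_mem) (auto simp: n_def)
          then show ?thesis using rs(3) by (auto simp: b_def)
        qed
        with \<open>n \<ge> 1\<close> have "E (prod_list
             (map (\<lambda>V. block_product c \<epsilon> b V - E (block_product c \<epsilon> b V))
                (sorted_key_list_of_set Min (max_alternating_partition n \<epsilon>)))) = 0"
          using L by blast
        moreover have "concat rs ! j = (\<epsilon> (1 + j), b (1 + j))" for j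
          by (simp add: \<epsilon>_def b_def)
        ultimately show "E z = 0"
          using eq[OF rs(2) n_def] unfolding z by simp
      qed
    next
      assume R: ?R
      show ?L
      proof (intro allI impI)
        fix n :: nat and \<epsilon> :: "nat \<Rightarrow> exponent" and b :: "nat \<Rightarrow> 'h bop"
        assume "1 \<le> n" and b: "\<forall>j\<in>{1..n}. b j \<in> B"
        define ws where "ws = map (\<lambda>j. (\<epsilon> j, b j)) [1..<1 + n]"
        have "ws \<noteq> []" using \<open>1 \<le> n\<close> by (simp add: ws_def)
        then obtain rs where rs: "rs \<noteq> []" "runs rs" "concat rs = ws"
          using runs_exist by blast
        have "set r \<subseteq> set ws" if "r \<in> set rs" for r
          using that by (auto simp flip: rs(3))
        moreover have "snd ` set ws \<subseteq> B"
          using b by (auto simp: ws_def)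
        ultimately have "\<forall>r\<in>set rs. snd ` set r \<subseteq> B"
          by blast
        then have "E (prod_list (map (\<lambda>x. x - E x) (map (word c) rs))) = 0"
          using R runs_imp_chain[OF rs(1,2)] by blast
        moreover have "n = length (concat rs)"
          "\<And>j. j < n \<Longrightarrow> concat rs ! j = (\<epsilon> (1 + j), b (1 + j))"
          by (auto simp: rs(3) ws_def nth_append simp del: upt_Suc)
        ultimately show "E (prod_list
             (map (\<lambda>V. block_product c \<epsilon> b V - E (block_product c \<epsilon> b V))
                (sorted_key_list_of_set Min (max_alternating_partition n \<epsilon>)))) = 0"
          using eq[OF rs(2)] by simp
      qed
    qed
  qed
  show ?thesis
    unfolding R_diagonal_def chain_vanishing_def using True odd[unfolded odd_word_def] even by blast
qed (simp add: R_diagonal_def)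

end

theorem proposition3p5:
  fixes A B :: "'h::complex_hilbert_space bop set"
    and E :: "'h bop \<Rightarrow> 'h bop"
    and a v h :: "'h bop"
  assumes "von_neumann_algebra B"
    and "W_noncommutative_probability_space B A E"
    and "R_diagonal B A E a"
    and "polar_decomposition a v h"
  shows "R_diagonal B A E v"
proof -
  interpret W_probability_space B A E
    by unfold_locales (rule assms(2))
  show ?thesis
    using assms(3,4) chain_vanishing_polar_part unfolding R_diagonal_iff_chain_vanishing by blast
qed

end
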